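(* Let $(a^i_\eta)_{1\le i\le\nu,\,\eta\in H}$ be complex numbers with $a^i_\eta=0$ whenever $\eta\notin H_i$ (the coefficients of a formal vector field, or of a formal tangent-to-identity diffeomorphism, as in the context), and let $\rho^<:\mathrm{CK}_H^\circ\to\mathbb{C}[x,\partial_x]$ be the associated linear map (homogeneous coarborification). Then $\rho^<$ is a Hopf morphism. That is, $\rho^<$ is a morphism of algebras (for the product of $\mathrm{CK}_H^\circ$ and the composition of differential operators), and it is compatible with coproducts: for every $D\in \mathrm{CK}_H^\circ$ with $\Delta(D)=\sum D_{(1)}\otimes D_{(2)}$ in $\mathrm{CK}_H^\circ$ and all $u,v\in\mathbb{C}[[x]]$, $\rho^<(D).(uv)=\sum(\rho^<(D_{(1)}).u)\,(\rho^<(D_{(2)}).v)$.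
   Context: Fix $\nu\ge1$, $x=(x_1,\dots,x_\nu)$, and let $e_i$ be the $i$-th canonical basis vector of $\mathbb{Z}^\nu$. For $1\le i\le\nu$ let $H_i=\{n-e_i:\ n\in\mathbb{N}^\nu,\ |n|\ge 2\}$, where $\mathbb N\ni 0$ and $|n|=n_1+\dots+n_\nu$, and let $H=H_1\cup\dots\cup H_\nu$. Put $x^\eta=x_1^{\eta_1}\cdots x_\nu^{\eta_\nu}$ and $\mathrm{gr}(\eta)=|\eta|=\eta_1+\dots+\eta_\nu\geq 1$ for $\eta\in H$. $\mathbb{C}[x,\partial_x]$ is the algebra of differential operators with polynomial coefficients, acting on $\mathbb{C}[[x]]$. The paper's coproduct on it is the one reflecting the action on products: $D.(uv)=\pi\circ\Delta(D).(u\otimes v)$, where $\pi$ is multiplication of series. Trees. $\mathcal F_H$ is the set of (isomorphism classes of) forests of non-planar rooted trees with vertices decorated by $H$, including the empty forest $\emptyset$. $B^+_\eta(F)$ is the tree obtained by joining the roots of the forest $F$ to a new root decorated by $\eta$, and $\bullet_\eta=B^+_\eta(\emptyset)$. The Connes–Kreimer Hopf algebra $\mathrm{CK}_H$ is the linear span of $\mathcal F_H$ with product the disjoint union of forests, unit $\emptyset$, and coproduct the algebra morphism with $\Delta(\emptyset)=\emptyset\otimes\emptyset$ and $\Delta(B^+_\eta(F))=B^+_\eta(F)\otimes\emptyset+(\mathrm{Id}\otimes B^+_\eta)\circ\Delta(F)$. It is graded by $\mathrm{gr}(F)=$ sum of the $\mathrm{gr}(\eta)$ over the decorations $\eta$ of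 $F$. $\mathrm{CK}_H^\circ$ is its graded dual Hopf algebra, with the basis dual to $\mathcal F_H$ identified with $\mathcal F_H$. Data. Either $P=\sum_{\eta\in H}\mathbb{B}_\eta$ is a formal vector field with $\mathbb{B}_\eta=\sum_{i}a^i_\eta x^\eta x_i\partial_{x_i}$ and $\rho(\eta)=\mathbb B_\eta$; or $f=(f_1,\dots,f_\nu)$ with $f_i(x)=x_i(1+\sum_{\eta\in H_i}a^i_\eta x^\eta)$ is a formal tangent-to-identity diffeomorphism and $\rho(\eta)=\mathbb D_\eta$ is the component of the operator $u\mapsto u\circ f$ that shifts the degrees of monomials by $\eta$. In both cases $\rho(\eta).x_i=a^i_\eta x^\eta x_i$ for $\eta\in H$. Definition of $\rho^<$. It is the linear map defined on the basis $\mathcal F_H$ of $\mathrm{CK}^\circ_H$ recursively by: $\rho^<(\emptyset)=\mathrm{Id}$; for a tree $T=B^+_\eta(F)$, $\rho^<(T)=\sum_{i=1}^\nu(\rho^<(F).(\rho(\eta).x_i))\,\partial_{x_i}$; and for a forest $F=T_1\cdots T_s$ with $s\ge2$ trees, consisting of $k$ distinct decorated trees with multiplicities $d_1,\dots,d_k$ ($d_1+\dots+d_k=s$), $\rho^<(F)=\frac{1}{d_1!\cdots d_k!}\sum_{1\le i_1,\dots,i_s\le\nu}(\rho^<(T_1).x_{i_1})\cdots(\rho^<(T_s).x_{i_s})\,\partial_{x_{i_1}}\cdots\partial_{x_{i_s}}$. *)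

theory Defs
  imports Complex_Main "HOL-Library.Multiset" "HOL-Library.Poly_Mapping" "HOL-Library.Product_Plus" "HOL-Combinatorics.Permutations"
begin

section \<open>The set of decorations\<close>

text \<open>The variables are indexed by a nonempty finite type \<open>'n\<close>, so that
  \<open>\<nu> = CARD('n)\<close>, and elements of \<open>\<int>\<^sup>\<nu>\<close> are functions \<open>'n \<Rightarrow> int\<close>.\<close>

definition ei :: "'n \<Rightarrow> 'n \<Rightarrow> int" where
  "ei i = (\<lambda>j. if j = i then 1 else 0)"

definition Hi :: "'n::finite \<Rightarrow> ('n \<Rightarrow> int) set" where
  "Hi i = {(\<lambda>j. int (n j) - ei i j) | n. (\<Sum>j\<in>UNIV. n j) \<ge> 2}"

typedef ('n::finite) dec = "(\<Union>i. Hi i) :: ('n \<Rightarrow> int) set"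
  morphisms expo Dec
proof -
  obtain i :: 'n where True by simp
  have "(\<lambda>j. int (if j = i then 2 else 0) - ei i j) \<in> Hi i"
    unfolding Hi_def by (intro CollectI exI[of _ "\<lambda>j. if j = i then 2 else 0"]) simp
  then show ?thesis by blast
qed

definition grd :: "'n::finite dec \<Rightarrow> int" where
  "grd \<eta> = (\<Sum>j\<in>UNIV. expo \<eta> j)"


section \<open>Formal power series in several variables\<close>

text \<open>A series is its family of coefficients, indexed by the exponents \<open>'n \<Rightarrow> nat\<close>.\<close>

typedef 'n mps = "UNIV :: (('n \<Rightarrow> nat) \<Rightarrow> complex) set"
  morphisms coeff Series by simp

lemma coeff_Series [simp]: "coeff (Series f) = f"
  by (simp add: Series_inverse)

lemma mps_eqI: "(\<And>\<alpha>. coeff u \<alpha> = coeff v \<alpha>) \<Longrightarrow> u = v"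
  by (metis coeff_inject ext)

definition splits :: "('n \<Rightarrow> nat) \<Rightarrow> (('n \<Rightarrow> nat) \<times> ('n \<Rightarrow> nat)) set" where
  "splits \<alpha> = {(\<beta>, \<gamma>). \<alpha> = (\<lambda>j. \<beta> j + \<gamma> j)}"

lemma finite_splits [simp]: "finite (splits (\<alpha> :: 'n::finite \<Rightarrow> nat))"
proof -
  have fin: "finite {\<beta>. \<forall>j. \<beta> j \<le> \<alpha> j}"
  proof -
    have "{\<beta>. \<forall>j. \<beta> j \<le> \<alpha> j} \<subseteq> {f. \<forall>j. (j \<in> UNIV \<longrightarrow> f j \<in> {..\<Sum>j\<in>UNIV. \<alpha> j}) \<and> (j \<notin> UNIV \<longrightarrow> f j = 0)}"
      by (auto intro: order_trans[OF _ member_le_sum])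
    then show ?thesis by (rule finite_subset) (rule finite_set_of_finite_funs; simp)
  qed
  have "splits \<alpha> \<subseteq> {\<beta>. \<forall>j. \<beta> j \<le> \<alpha> j} \<times> {\<beta>. \<forall>j. \<beta> j \<le> \<alpha> j}"
    by (auto simp: splits_def)
  then show ?thesis using fin finite_subset by blast
qed

instantiation mps :: (finite) comm_ring_1
begin

definition "0 = Series (\<lambda>\<alpha>. 0)"
definition "1 = Series (\<lambda>\<alpha>. if \<alpha> = (\<lambda>j. 0) then 1 else 0)"
definition "u + v = Series (\<lambda>\<alpha>. coeff u \<alpha> + coeff v \<alpha>)"
definition "- u = Series (\<lambda>\<alpha>. - coeff u \<alpha>)"
definition "u - v = Series (\<lambda>\<alpha>. coeff u \<alpha> - coeff v \<alpha>)"
definition "u * v = Series (\<lambda>\<alpha>. \<Sum>(\<beta>, \<gamma>)\<in>splits \<alpha>. coeff u \<beta> * coeff v \<gamma>)"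

instance
proof
  fix u v w :: "'a mps"
  show "u * v * w = u * (v * w)"
  proof (rule mps_eqI)
    fix \<alpha> :: "'a \<Rightarrow> nat"
    have "coeff (u * v * w) \<alpha> =
        (\<Sum>(p, q)\<in>(SIGMA p:splits \<alpha>. splits (fst p)). coeff u (fst q) * coeff v (snd q) * coeff w (snd p))"
      by (simp add: times_mps_def sum.Sigma sum_distrib_right split_beta)
    also have "\<dots> =
        (\<Sum>(p, q)\<in>(SIGMA p:splits \<alpha>. splits (snd p)). coeff u (fst p) * (coeff v (fst q) * coeff w (snd q)))"
      by (rule sum.reindex_bij_witness[where
            i = "\<lambda>(p, q). ((\<lambda>j. fst p j + fst q j, snd q), (fst p, fst q))" and
            j = "\<lambda>(p, q). ((fst q, \<lambda>j. snd q j + snd p j), (snd q, snd p))"])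
        (auto simp: splits_def add.assoc mult.assoc)
    also have "\<dots> = coeff (u * (v * w)) \<alpha>"
      by (simp add: times_mps_def sum.Sigma sum_distrib_left split_beta)
    finally show "coeff (u * v * w) \<alpha> = coeff (u * (v * w)) \<alpha>" .
  qed
  show "u * v = v * u"
  proof (rule mps_eqI)
    fix \<alpha> :: "'a \<Rightarrow> nat"
    show "coeff (u * v) \<alpha> = coeff (v * u) \<alpha>"
      unfolding times_mps_def coeff_Series
      by (rule sum.reindex_bij_witness[where i = prod.swap and j = prod.swap])
        (auto simp: splits_def add.commute mult.commute)
  qed
  show "1 * u = u"
  proof (rule mps_eqI)
    fix \<alpha> :: "'a \<Rightarrow> nat"
    have "coeff (1 * u) \<alpha> = (\<Sum>(\<beta>, \<gamma>)\<in>{(\<lambda>j. 0, \<alpha>)}. coeff (1 :: 'a mps) \<beta> * coeff u \<gamma>)"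
      unfolding times_mps_def coeff_Series
      by (rule sum.mono_neutral_right[OF finite_splits])
        (auto simp: splits_def one_mps_def split: if_splits)
    then show "coeff (1 * u) \<alpha> = coeff u \<alpha>" by (simp add: one_mps_def)
  qed
  show "(u + v) * w = u * w + v * w"
    by (rule mps_eqI)
      (simp add: times_mps_def plus_mps_def distrib_right split_beta sum.distrib)
  show "(0 :: 'a mps) \<noteq> 1"
  proof
    assume "(0 :: 'a mps) = 1"
    then have "coeff (0 :: 'a mps) (\<lambda>j. 0) = coeff 1 (\<lambda>j. 0)" by simp
    then show False by (simp add: zero_mps_def one_mps_def)
  qed
qed (auto intro!: mps_eqI simp: plus_mps_def zero_mps_def uminus_mps_def minus_mps_def)

end

definition const :: "complex \<Rightarrow> 'n mps" where
  "const c = Series (\<lambda>\<alpha>. if \<alpha> = (\<lambda>j. 0) then c else 0)"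

definition var :: "'n \<Rightarrow> 'n mps" where
  "var i = Series (\<lambda>\<alpha>. if \<alpha> = (\<lambda>j. if j = i then 1 else 0) then 1 else 0)"

text \<open>The monomial with exponent \<open>m \<in> \<int>\<^sup>\<nu>\<close>; the junk value \<open>0\<close> for exponents with a negative
  entry only ever occurs multiplied by a vanishing coefficient.\<close>

definition xpow :: "('n \<Rightarrow> int) \<Rightarrow> 'n mps" where
  "xpow m = Series (\<lambda>\<alpha>. if (\<lambda>j. int (\<alpha> j)) = m then 1 else 0)"

definition pd :: "'n \<Rightarrow> 'n mps \<Rightarrow> 'n mps" where
  "pd i u = Series (\<lambda>\<alpha>. of_nat (\<alpha> i + 1) * coeff u (\<alpha>(i := \<alpha> i + 1)))"

text \<open>\<open>pds [i\<^sub>1, \<dots>, i\<^sub>s]\<close> is the composition of the partial derivatives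
  with respect to \<open>x\<^sub>i\<close> for \<open>i = i\<^sub>1, \<dots>, i\<^sub>s\<close>.\<close>

definition pds :: "'n list \<Rightarrow> 'n mps \<Rightarrow> 'n mps" where
  "pds is = foldr pd is"

type_synonym 'n operator = "'n mps \<Rightarrow> 'n mps"

definition is_polynomial :: "'n mps \<Rightarrow> bool" where
  "is_polynomial u \<longleftrightarrow> finite {\<alpha>. coeff u \<alpha> \<noteq> 0}"

text \<open>Differential operators with polynomial coefficients are identified with the operators on
  series that they define (the action is faithful); their product is the composition.\<close>

definition diff_ops :: "'n::finite operator set" where
  "diff_ops = {(\<lambda>u. \<Sum>is\<in>S. p is * pds is u) | S p. finite S \<and> (\<forall>is\<in>S. is_polynomial (p is))}"


section \<open>Vector fields and diffeomorphisms\<close>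

definition vf_comp :: "('n::finite \<Rightarrow> 'n dec \<Rightarrow> complex) \<Rightarrow> 'n dec \<Rightarrow> 'n operator" where
  "vf_comp a \<eta> u = (\<Sum>i\<in>UNIV. const (a i \<eta>) * xpow (\<lambda>j. expo \<eta> j + ei i j) * pd i u)"

text \<open>The series \<open>f\<^sub>i = x\<^sub>i (1 + \<Sum>\<^bsub>\<eta>\<in>H\<^sub>i\<^esub> a i \<eta> x\<^sup>\<eta>)\<close>.\<close>

definition diffeo :: "('n::finite \<Rightarrow> 'n dec \<Rightarrow> complex) \<Rightarrow> 'n \<Rightarrow> 'n mps" where
  "diffeo a i = var i + Series (\<lambda>\<alpha>. if (\<Sum>j\<in>UNIV. \<alpha> j) \<ge> 2
      then a i (Dec (\<lambda>j. int (\<alpha> j) - ei i j)) else 0)"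

text \<open>Since the components of \<open>f\<close> have no constant term, \<open>f\<^sup>\<beta>\<close> only contributes to the coefficient
  of \<open>x\<^sup>\<alpha>\<close> in \<open>u \<circ> f\<close> if \<open>|\<beta>| \<le> |\<alpha>|\<close>.\<close>

definition subst :: "('n::finite \<Rightarrow> 'n mps) \<Rightarrow> 'n operator" where
  "subst f u = Series (\<lambda>\<alpha>. \<Sum>\<beta> | (\<Sum>j\<in>UNIV. \<beta> j) \<le> (\<Sum>j\<in>UNIV. \<alpha> j).
      coeff u \<beta> * coeff (\<Prod>j\<in>UNIV. f j ^ \<beta> j) \<alpha>)"

text \<open>The component of an operator that maps each monomial \<open>x\<^sup>\<beta>\<close> to a multiple of \<open>x\<^bsup>\<beta>+\<eta>\<^esup>\<close>.\<close>

definition shift_comp :: "'n operator \<Rightarrow> ('n \<Rightarrow> int) \<Rightarrow> 'n operator" where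
  "shift_comp \<Phi> \<eta> u = Series (\<lambda>\<alpha>. if \<forall>j. \<eta> j \<le> int (\<alpha> j)
      then coeff u (\<lambda>j. nat (int (\<alpha> j) - \<eta> j)) * coeff (\<Phi> (xpow (\<lambda>j. int (\<alpha> j) - \<eta> j))) \<alpha>
      else 0)"

definition diffeo_comp :: "('n::finite \<Rightarrow> 'n dec \<Rightarrow> complex) \<Rightarrow> 'n dec \<Rightarrow> 'n operator" where
  "diffeo_comp a \<eta> = shift_comp (subst (diffeo a)) (expo \<eta>)"


section \<open>The Connes--Kreimer Hopf algebra\<close>

datatype 'd rtree = Node 'd "'d rtree multiset"

type_synonym 'n forest = "'n dec rtree multiset"

primrec gr_tree :: "'n::finite dec rtree \<Rightarrow> int" where
  "gr_tree (Node \<eta> F) = grd \<eta> + sum_mset (image_mset gr_tree F)"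

definition gr :: "'n::finite forest \<Rightarrow> int" where
  "gr F = (\<Sum>T\<in>#F. gr_tree T)"

text \<open>Disjoint union of forests is the addition of multisets, so the multiplication of
  \<open>\<Rightarrow>\<^sub>0\<close> (convolution) makes the types below the algebra \<open>CK\<^sub>H\<close> and its tensor square.\<close>

type_synonym 'n ck = "'n forest \<Rightarrow>\<^sub>0 complex"
type_synonym 'n ck2 = "('n forest \<times> 'n forest) \<Rightarrow>\<^sub>0 complex"

definition scale :: "complex \<Rightarrow> ('b \<Rightarrow>\<^sub>0 complex) \<Rightarrow> ('b \<Rightarrow>\<^sub>0 complex)" where
  "scale c w = Poly_Mapping.map ((*) c) w"

definition bplus :: "'n::finite dec \<Rightarrow> 'n forest \<Rightarrow> 'n forest" where
  "bplus \<eta> F = {#Node \<eta> F#}"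

definition id_bplus :: "'n::finite dec \<Rightarrow> 'n ck2 \<Rightarrow> 'n ck2" where
  "id_bplus \<eta> z = (\<Sum>(F, G)\<in>Poly_Mapping.keys z.
      Poly_Mapping.single (F, bplus \<eta> G) (Poly_Mapping.lookup z (F, G)))"

primrec coprod_tree :: "'n::finite dec rtree \<Rightarrow> 'n ck2" where
  "coprod_tree (Node \<eta> F) =
     Poly_Mapping.single (bplus \<eta> F, {#}) 1 + id_bplus \<eta> (prod_mset (image_mset coprod_tree F))"

definition coprod :: "'n::finite ck \<Rightarrow> 'n ck2" where
  "coprod w = (\<Sum>F\<in>Poly_Mapping.keys w.
      scale (Poly_Mapping.lookup w F) (\<Prod>T\<in>#F. coprod_tree T))"

definition mult_ck :: "'n::finite ck2 \<Rightarrow> 'n ck" where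
  "mult_ck z = (\<Sum>(F, G)\<in>Poly_Mapping.keys z.
      Poly_Mapping.single (F + G) (Poly_Mapping.lookup z (F, G)))"


section \<open>The graded dual\<close>

type_synonym 'n functional = "'n ck \<Rightarrow> complex"

text \<open>Linear forms that vanish on all but finitely many homogeneous components.\<close>

definition ck_dual :: "'n::finite functional set" where
  "ck_dual = {\<phi>. (\<forall>v w. \<phi> (v + w) = \<phi> v + \<phi> w) \<and> (\<forall>c w. \<phi> (scale c w) = c * \<phi> w) \<and>
     (\<exists>N. \<forall>F. gr F > N \<longrightarrow> \<phi> (Poly_Mapping.single F 1) = 0)}"

definition dual_basis :: "'n::finite forest \<Rightarrow> 'n functional" where
  "dual_basis F = (\<lambda>w. Poly_Mapping.lookup w F)"

definition tensor :: "'n::finite functional \<Rightarrow> 'n functional \<Rightarrow> 'n ck2 \<Rightarrow> complex" where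
  "tensor \<phi> \<psi> z = (\<Sum>(F, G)\<in>Poly_Mapping.keys z.
      Poly_Mapping.lookup z (F, G) * \<phi> (Poly_Mapping.single F 1) * \<psi> (Poly_Mapping.single G 1))"

text \<open>The unit is the counit of \<open>CK\<^sub>H\<close>, and product and coproduct are the transposes of the
  coproduct and the product of \<open>CK\<^sub>H\<close>. The coproduct of \<open>\<phi>\<close> is given as a linear form on
  \<open>CK\<^sub>H \<otimes> CK\<^sub>H\<close>.\<close>

definition dual_unit :: "'n::finite functional" where
  "dual_unit = dual_basis {#}"

definition dual_mult :: "'n::finite functional \<Rightarrow> 'n functional \<Rightarrow> 'n functional" where
  "dual_mult \<phi> \<psi> = (\<lambda>w. tensor \<phi> \<psi> (coprod w))"

definition dual_coprod :: "'n::finite functional \<Rightarrow> 'n ck2 \<Rightarrow> complex" where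
  "dual_coprod \<phi> = (\<lambda>z. \<phi> (mult_ck z))"


section \<open>Homogeneous coarborification\<close>

definition multi_op :: "'n::finite operator list \<Rightarrow> 'n operator" where
  "multi_op As u = (\<Sum>is | length is = length As.
      (\<Prod>j<length As. (As ! j) (var (is ! j))) * pds is u)"

definition symfactor :: "'n::finite forest \<Rightarrow> complex" where
  "symfactor F = (\<Prod>T\<in>set_mset F. fact (count F T))"

text \<open>The operator of a forest \<open>F\<close>, where \<open>M\<close> is the multiset of the operators of its trees; the
  trees are enumerated in an arbitrary order, on which the result does not depend.\<close>

definition forest_op :: "'n::finite forest \<Rightarrow> 'n operator multiset \<Rightarrow> 'n operator" where
  "forest_op F M = (case (SOME As. mset As = M) of
       [] \<Rightarrow> id
     | [A] \<Rightarrow> A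
     | As \<Rightarrow> (\<lambda>u. const (1 / symfactor F) * multi_op As u))"

primrec coarb_tree :: "('n::finite dec \<Rightarrow> 'n operator) \<Rightarrow> 'n dec rtree \<Rightarrow> 'n operator" where
  "coarb_tree \<rho> (Node \<eta> F) =
     (\<lambda>u. \<Sum>i\<in>UNIV. forest_op F (image_mset (coarb_tree \<rho>) F) (\<rho> \<eta> (var i)) * pd i u)"

definition coarb_forest :: "('n::finite dec \<Rightarrow> 'n operator) \<Rightarrow> 'n forest \<Rightarrow> 'n operator" where
  "coarb_forest \<rho> F = forest_op F (image_mset (coarb_tree \<rho>) F)"

text \<open>The linear extension, the element \<open>\<phi>\<close> of the graded dual being the finite combination of the
  \<open>dual_basis F\<close> with coefficients \<open>\<phi> (single F 1)\<close>.\<close>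

definition coarb :: "('n::finite dec \<Rightarrow> 'n operator) \<Rightarrow> 'n functional \<Rightarrow> 'n operator" where
  "coarb \<rho> \<phi> u = (\<Sum>F | \<phi> (Poly_Mapping.single F 1) \<noteq> 0.
      const (\<phi> (Poly_Mapping.single F 1)) * coarb_forest \<rho> F u)"

section \<open>Basic consequences of the definitions\<close>

lemma coeff_const_mult: "coeff (const c * (u :: 'n::finite mps)) \<alpha> = c * coeff u \<alpha>"
proof -
  have "coeff (const c * u) \<alpha> = (\<Sum>(\<beta>, \<gamma>)\<in>{(\<lambda>j. 0, \<alpha>)}. coeff (const c :: 'n mps) \<beta> * coeff u \<gamma>)"
    unfolding times_mps_def coeff_Series
    by (rule sum.mono_neutral_right[OF finite_splits])
      (auto simp: splits_def const_def split: if_splits)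
  then show ?thesis by (simp add: const_def)
qed

text \<open>Both kinds of data satisfy \<open>\<rho>(\<eta>).x\<^sub>i = a i \<eta> x\<^sup>\<eta> x\<^sub>i\<close>.\<close>

lemma vf_comp_var:
  fixes a :: "'n::finite \<Rightarrow> 'n dec \<Rightarrow> complex"
  shows "vf_comp a \<eta> (var i) = const (a i \<eta>) * xpow (\<lambda>j. expo \<eta> j + ei i j)"
proof -
  have "pd k (var i) = (if k = i then 1 else 0)" for k
  proof (rule mps_eqI)
    fix \<alpha> :: "'n \<Rightarrow> nat"
    have "\<alpha>(k := \<alpha> k + 1) = (\<lambda>j. if j = i then 1 else 0) \<longleftrightarrow> k = i \<and> \<alpha> = (\<lambda>j. 0)" (is "?f = ?g \<longleftrightarrow> _")
    proof
      assume eq: "?f = ?g"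
      have "k = i" using fun_cong[OF eq, of k] by (auto split: if_splits)
      moreover have "\<alpha> j = 0" for j using fun_cong[OF eq, of j] \<open>k = i\<close> by (simp split: if_splits)
      ultimately show "k = i \<and> \<alpha> = (\<lambda>j. 0)" by blast
    qed auto
    then show "coeff (pd k (var i)) \<alpha> = coeff (if k = i then 1 else 0) \<alpha>"
      by (simp add: pd_def var_def one_mps_def zero_mps_def)
  qed
  then have "vf_comp a \<eta> (var i) =
      (\<Sum>k\<in>UNIV. if k = i then const (a k \<eta>) * xpow (\<lambda>j. expo \<eta> j + ei k j) else 0)"
    unfolding vf_comp_def by (intro sum.cong) auto
  then show ?thesis by simp
qed

lemma finite_degree_le: "finite {\<beta> :: 'n::finite \<Rightarrow> nat. (\<Sum>j\<in>UNIV. \<beta> j) \<le> N}"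
proof -
  have "{\<beta> :: 'n \<Rightarrow> nat. (\<Sum>j\<in>UNIV. \<beta> j) \<le> N} \<subseteq>
      {f. \<forall>j. (j \<in> UNIV \<longrightarrow> f j \<in> {..N}) \<and> (j \<notin> UNIV \<longrightarrow> f j = 0)}"
  proof clarsimp
    fix \<beta> :: "'n \<Rightarrow> nat" and j assume "(\<Sum>j\<in>UNIV. \<beta> j) \<le> N"
    moreover have "\<beta> j \<le> (\<Sum>j\<in>UNIV. \<beta> j)" by (rule member_le_sum) auto
    ultimately show "\<beta> j \<le> N" by linarith
  qed
  then show ?thesis by (rule finite_subset) (rule finite_set_of_finite_funs; simp)
qed

lemma diffeo_comp_var: "diffeo_comp a \<eta> (var i) = const (a i \<eta>) * xpow (\<lambda>j. expo \<eta> j + ei i j)"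
proof (rule mps_eqI)
  fix \<alpha>
  let ?l = "coeff (diffeo_comp a \<eta> (var i)) \<alpha>"
  show "?l = coeff (const (a i \<eta>) * xpow (\<lambda>j. expo \<eta> j + ei i j)) \<alpha>"
  proof (cases "(\<lambda>j. int (\<alpha> j)) = (\<lambda>j. expo \<eta> j + ei i j)")
    case False
    have "(\<lambda>j. nat (int (\<alpha> j) - expo \<eta> j)) \<noteq> (\<lambda>j. if j = i then 1 else 0)"
      if "\<forall>j. expo \<eta> j \<le> int (\<alpha> j)"
    proof
      assume *: "(\<lambda>j. nat (int (\<alpha> j) - expo \<eta> j)) = (\<lambda>j. if j = i then 1 else 0)"
      have "int (\<alpha> j) = expo \<eta> j + ei i j" for j
        using fun_cong[OF *, of j] that[rule_format, of j] by (auto simp: ei_def split: if_splits)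
      then show False using False by auto
    qed
    then have "coeff (var i) (\<lambda>j. nat (int (\<alpha> j) - expo \<eta> j)) = 0" if "\<forall>j. expo \<eta> j \<le> int (\<alpha> j)"
      unfolding var_def coeff_Series using that by (intro if_not_P)
    then have "?l = 0"
      unfolding diffeo_comp_def shift_comp_def coeff_Series
      by (cases "\<forall>j. expo \<eta> j \<le> int (\<alpha> j)") (simp_all only: simp_thms mult_zero_left if_True if_False)
    moreover have "coeff (xpow (\<lambda>j. expo \<eta> j + ei i j)) \<alpha> = 0"
      unfolding xpow_def coeff_Series using False by (rule if_not_P)
    ultimately show ?thesis by (simp only: coeff_const_mult mult_zero_right)
  next
    case True
    then have \<alpha>: "int (\<alpha> j) = expo \<eta> j + ei i j" for j by (rule fun_cong)
    obtain k n where n: "expo \<eta> = (\<lambda>j. int (n j) - ei k j)" "(\<Sum>j\<in>UNIV. n j) \<ge> 2"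
      using expo[of \<eta>] by (auto simp: Hi_def)
    have "int (\<Sum>j\<in>UNIV. \<alpha> j) = int (\<Sum>j\<in>UNIV. n j)"
      by (simp add: \<alpha> n(1) ei_def sum.distrib sum_subtractf)
    with n(2) have deg: "(\<Sum>j\<in>UNIV. \<alpha> j) \<ge> 2" by linarith
    have le: "\<forall>j. expo \<eta> j \<le> int (\<alpha> j)" by (simp add: \<alpha> ei_def)
    let ?e = "\<lambda>j. if j = i then 1 else 0 :: nat"
    have e: "(\<lambda>j. int (\<alpha> j) - expo \<eta> j) = (\<lambda>j. int (?e j))" by (auto simp: \<alpha> ei_def)
    have e': "(\<lambda>j. nat (int (\<alpha> j) - expo \<eta> j)) = ?e" by (auto simp: \<alpha> ei_def)
    have "?l = coeff (subst (diffeo a) (xpow (\<lambda>j. int (?e j)))) \<alpha>"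
      unfolding diffeo_comp_def shift_comp_def coeff_Series e e' if_P[OF le] by (simp add: var_def)
    also have "\<dots> = (\<Sum>\<beta>\<in>{?e}. coeff (xpow (\<lambda>j. int (?e j))) \<beta> *
        coeff (\<Prod>j\<in>UNIV. diffeo a j ^ \<beta> j) \<alpha>)"
      unfolding subst_def coeff_Series using deg
      by (intro sum.mono_neutral_right) (auto simp: finite_degree_le xpow_def fun_eq_iff[of "\<lambda>j. int (_ j)"])
    also have "\<dots> = coeff (\<Prod>j\<in>UNIV. if j = i then diffeo a j else 1) \<alpha>"
    proof -
      have "(\<Prod>j\<in>UNIV. diffeo a j ^ ?e j) = (\<Prod>j\<in>UNIV. if j = i then diffeo a j else 1)"
        by (rule prod.cong) auto
      then show ?thesis by (simp only: xpow_def coeff_Series sum.insert_if sum.empty finite.emptyI empty_iff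
            if_False if_True mult_1_left add_0_right simp_thms)
    qed
    also have "\<dots> = coeff (diffeo a i) \<alpha>" by simp
    also have "\<dots> = a i (Dec (\<lambda>j. int (\<alpha> j) - ei i j))"
      using deg by (auto simp: diffeo_def plus_mps_def var_def)
    also have "\<dots> = a i \<eta>" by (simp add: \<alpha> expo_inverse)
    finally show ?thesis using True by (simp add: coeff_const_mult xpow_def)
  qed
qed

lemma coarb_forest_empty: "coarb_forest \<rho> {#} = id"
  by (simp add: coarb_forest_def forest_op_def)

lemma forest_op_single: "forest_op F {#A#} = A"
proof -
  have "(SOME As. mset As = {#A#}) = [A]"
    by (rule some_equality) (auto simp: mset_single_iff)
  then show ?thesis by (simp add: forest_op_def)
qed

lemma coarb_forest_tree:
  "coarb_forest \<rho> (bplus \<eta> F) u = (\<Sum>i\<in>UNIV. coarb_forest \<rho> F (\<rho> \<eta> (var i)) * pd i u)"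
  by (simp add: coarb_forest_def forest_op_single bplus_def)

lemma pd_commute: "pd i (pd j u) = pd j (pd i u)"
  by (rule mps_eqI) (simp add: pd_def fun_upd_twist algebra_simps)

lemma pds_mset_cong:
  assumes "mset is = mset js"
  shows "pds is = pds js"
proof -
  have "fold pd (rev is) = fold pd (rev js)"
    by (rule fold_permuted_eq[where P = "\<lambda>_. True", THEN ext])
       (use assms in \<open>auto simp: pd_commute\<close>)
  then show ?thesis by (simp add: pds_def foldr_conv_fold)
qed

lemma multi_op_mset_cong:
  assumes "mset As = mset Bs"
  shows "multi_op As = (multi_op Bs :: 'n::finite operator)"
proof -
  have len: "length As = length Bs" using assms by (rule mset_eq_length)
  obtain p where p: "p permutes {..<length Bs}" "permute_list p Bs = As"
    using mset_eq_permutation[OF assms] by blast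
  have [simp]: "permute_list (inv p) (permute_list p is) = is" "permute_list p (permute_list (inv p) is) = is"
    if "length is = length Bs" for "is" :: "'n list"
    using p(1) that permutes_inv[OF p(1)]
    by (simp_all flip: permute_list_compose add: permutes_inv_o)
  show ?thesis
  proof
    fix u
    show "multi_op As u = multi_op Bs u" unfolding multi_op_def
    proof (rule sum.reindex_bij_witness[where i = "permute_list p" and j = "permute_list (inv p)"];
        clarsimp simp: len)
      fix "is" :: "'n list" assume l: "length is = length Bs"
      let ?js = "permute_list (inv p) is"
      have ip: "inv p permutes {..<length is}" using permutes_inv[OF p(1)] l by simp
      have "(\<Prod>j<length Bs. (Bs ! j) (var (?js ! j)))
          = (\<Prod>j<length Bs. (Bs ! p j) (var (?js ! p j)))"
        using prod.permute[OF p(1), of "\<lambda>j. (Bs ! j) (var (?js ! j))"] by (simp add: o_def)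
      also have "\<dots> = (\<Prod>j<length Bs. (As ! j) (var (is ! j)))"
      proof (rule prod.cong[OF refl])
        fix j assume j: "j \<in> {..<length Bs}"
        have pj: "p j < length is" using permutes_in_image[OF p(1)] j l by auto
        have "?js ! p j = is ! j"
          using permute_list_nth[OF ip pj] by (simp add: permutes_inverses[OF p(1)])
        moreover have "As ! j = Bs ! p j"
          using permute_list_nth[OF p(1), of j] j p(2) by simp
        ultimately show "(Bs ! p j) (var (?js ! p j)) = (As ! j) (var (is ! j))" by simp
      qed
      finally show "(\<Prod>j<length Bs. (Bs ! j) (var (?js ! j))) * pds ?js u =
          (\<Prod>j<length Bs. (As ! j) (var (is ! j))) * pds is u"
        using pds_mset_cong[OF mset_permute_list[OF ip]] by simp
    qed
  qed
qed

lemma coarb_forest_forest: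
  assumes "length Ts \<ge> 2"
  shows "coarb_forest \<rho> (mset Ts) u = const (1 / symfactor (mset Ts)) *
    (\<Sum>is | length is = length Ts.
      (\<Prod>j<length Ts. coarb_forest \<rho> {#Ts ! j#} (var (is ! j))) * pds is u)"
proof -
  define As where "As = (SOME As. mset As = image_mset (coarb_tree \<rho>) (mset Ts))"
  have As: "mset As = mset (map (coarb_tree \<rho>) Ts)"
    unfolding As_def mset_map using ex_mset by (rule someI_ex)
  have "length As = length Ts" using As by (metis length_map mset_eq_length)
  with assms obtain A B Cs where "As = A # B # Cs"
    by (cases As rule: remdups_adj.cases) auto
  then have "coarb_forest \<rho> (mset Ts) u = const (1 / symfactor (mset Ts)) * multi_op As u"
    by (simp add: coarb_forest_def forest_op_def As_def[symmetric])
  also have "multi_op As = multi_op (map (coarb_tree \<rho>) Ts)"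
    by (rule multi_op_mset_cong[OF As])
  finally show ?thesis
    by (simp add: multi_op_def coarb_forest_def forest_op_single)
qed

lemma lookup_scale [simp]: "Poly_Mapping.lookup (scale c w) k = c * Poly_Mapping.lookup w k"
  by (simp add: scale_def Poly_Mapping.map.rep_eq when_def)

lemma scale_add: "scale c (v + w) = scale c v + scale c w"
  and scale_add_left: "scale (c + d) w = scale c w + scale d w"
  and scale_scale: "scale c (scale d w) = scale (c * d) w"
  and scale_0 [simp]: "scale 0 w = 0"
  and scale_1 [simp]: "scale 1 w = w"
  and scale_single: "scale c (Poly_Mapping.single k d) = Poly_Mapping.single k (c * d)"
  by (auto intro!: poly_mapping_eqI simp: lookup_add algebra_simps lookup_single when_def)

lemma scale_mult:
  fixes v w :: "'b::comm_monoid_add \<Rightarrow>\<^sub>0 complex"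
  shows "scale c v * scale d w = scale (c * d) (v * w)"
proof -
  have "scale c v * scale d w = (Poly_Mapping.single 0 c * Poly_Mapping.single 0 d) * (v * w)"
    by (simp add: scale_def mult_map_scale_conv_mult ac_simps)
  then show ?thesis by (simp add: scale_def mult_map_scale_conv_mult mult_single)
qed

lemma sum_keys_superset:
  assumes "finite S" "Poly_Mapping.keys w \<subseteq> S" "\<And>k. h k 0 = 0"
  shows "(\<Sum>k\<in>Poly_Mapping.keys w. h k (Poly_Mapping.lookup w k)) = (\<Sum>k\<in>S. h k (Poly_Mapping.lookup w k))"
  using assms by (intro sum.mono_neutral_left) (auto simp: in_keys_iff)

lemma sum_keys_add:
  assumes "\<And>k. h k 0 = 0" "\<And>k c d. h k (c + d) = h k c + h k d"
  shows "(\<Sum>k\<in>Poly_Mapping.keys (v + w). h k (Poly_Mapping.lookup (v + w) k)) =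
    (\<Sum>k\<in>Poly_Mapping.keys v. h k (Poly_Mapping.lookup v k)) +
    (\<Sum>k\<in>Poly_Mapping.keys w. h k (Poly_Mapping.lookup w k))"
proof -
  let ?S = "Poly_Mapping.keys v \<union> Poly_Mapping.keys w"
  have "Poly_Mapping.keys (v + w) \<subseteq> ?S" by (rule Poly_Mapping.keys_add)
  then have "(\<Sum>k\<in>Poly_Mapping.keys (v + w). h k (Poly_Mapping.lookup (v + w) k)) =
      (\<Sum>k\<in>?S. h k (Poly_Mapping.lookup (v + w) k))"
    by (intro sum_keys_superset assms(1)) auto
  also have "\<dots> = (\<Sum>k\<in>?S. h k (Poly_Mapping.lookup v k)) + (\<Sum>k\<in>?S. h k (Poly_Mapping.lookup w k))"
    by (simp add: lookup_add assms(2) sum.distrib)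
  also have "(\<Sum>k\<in>?S. h k (Poly_Mapping.lookup v k)) = (\<Sum>k\<in>Poly_Mapping.keys v. h k (Poly_Mapping.lookup v k))"
    by (intro sum_keys_superset[symmetric] assms(1)) auto
  also have "(\<Sum>k\<in>?S. h k (Poly_Mapping.lookup w k)) = (\<Sum>k\<in>Poly_Mapping.keys w. h k (Poly_Mapping.lookup w k))"
    by (intro sum_keys_superset[symmetric] assms(1)) auto
  finally show ?thesis .
qed

lemma coprod_add: "coprod (v + w) = coprod v + coprod w"
  unfolding coprod_def by (rule sum_keys_add) (simp_all add: scale_add_left)

lemma coprod_single:
  "coprod (Poly_Mapping.single F c) = scale c (\<Prod>T\<in>#F. coprod_tree T)"
  by (simp add: coprod_def)

lemma coprod_0 [simp]: "coprod 0 = 0"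
  by (simp add: coprod_def)

lemma coprod_sum: "coprod (sum h S) = (\<Sum>s\<in>S. coprod (h s))"
  by (induction S rule: infinite_finite_induct) (auto simp: coprod_add)

lemma sum_singles: "w = (\<Sum>k\<in>Poly_Mapping.keys w. Poly_Mapping.single k (Poly_Mapping.lookup w k))"
  by (rule poly_mapping_eqI)
    (simp add: lookup_sum lookup_single when_def in_keys_iff)

lemma coprod_scale: "coprod (scale c w) = scale c (coprod w)"
proof -
  have *: "scale c (sum h S) = (\<Sum>s\<in>S. scale c (h s))"
    for h :: "'c \<Rightarrow> 'b \<Rightarrow>\<^sub>0 complex" and S
    by (rule poly_mapping_eqI) (simp add: lookup_sum sum_distrib_left)
  show ?thesis
    by (subst sum_singles[of w]) (simp add: * scale_single coprod_sum coprod_single scale_scale coprod_def[of w])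
qed

text \<open>The equations characterising the coproduct.\<close>

lemma coprod_one: "coprod 1 = 1"
  using coprod_single[of "{#}" 1] by (simp flip: single_one zero_multiset_def)

lemma coprod_mult: "coprod (v * w) = coprod v * coprod w"
proof -
  have "coprod (v * w) = (\<Sum>F\<in>Poly_Mapping.keys v. \<Sum>G\<in>Poly_Mapping.keys w.
     coprod (Poly_Mapping.single F (Poly_Mapping.lookup v F) * Poly_Mapping.single G (Poly_Mapping.lookup w G)))"
    by (subst sum_singles[of v], subst sum_singles[of w])
      (simp add: sum_distrib_left sum_distrib_right coprod_sum, rule sum.swap)
  also have "\<dots> = coprod v * coprod w"
    by (simp add: mult_single coprod_single coprod_def[of v] coprod_def[of w]
        sum_distrib_left sum_distrib_right scale_mult)
       (rule sum.swap)
  finally show ?thesis .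
qed

lemma coprod_bplus:
  "coprod (Poly_Mapping.single (bplus \<eta> F) 1) =
    Poly_Mapping.single (bplus \<eta> F, {#}) 1 + id_bplus \<eta> (coprod (Poly_Mapping.single F 1))"
  by (simp add: coprod_single bplus_def)

text \<open>Homogeneity, and finiteness of the homogeneous components.\<close>

lemma grd_ge_1: "grd \<eta> \<ge> 1"
proof -
  obtain i n where n: "expo \<eta> = (\<lambda>j. int (n j) - ei i j)" "(\<Sum>j\<in>UNIV. n j) \<ge> 2"
    using expo[of \<eta>] by (auto simp: Hi_def)
  have "grd \<eta> = int (\<Sum>j\<in>UNIV. n j) - 1"
    by (simp add: grd_def n(1) ei_def sum_subtractf)
  then show ?thesis using n(2) by linarith
qed

lemma gr_tree_ge_1: "gr_tree T \<ge> 1"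
proof (induction T)
  case (Node \<eta> F)
  have "0 \<le> (\<Sum>T\<in>#F. gr_tree T)"
    using Node by (induction F) force+
  then show ?case using grd_ge_1[of \<eta>] by simp
qed

lemma gr_ge_size: "gr F \<ge> int (size F)"
  unfolding gr_def by (induction F) (use gr_tree_ge_1 in \<open>auto intro: add_mono\<close>)

lemma gr_empty [simp]: "gr {#} = 0" and gr_union [simp]: "gr (F + G) = gr F + gr G"
  and gr_bplus [simp]: "gr (bplus \<eta> F) = grd \<eta> + gr F"
  by (simp_all add: gr_def bplus_def)

lemma finite_grd_le: "finite {\<eta> :: 'n::finite dec. grd \<eta> \<le> N}"
proof -
  let ?A = "{f :: 'n \<Rightarrow> int. \<forall>j. (j \<in> UNIV \<longrightarrow> f j \<in> {-1..N + 1}) \<and> (j \<notin> UNIV \<longrightarrow> f j = 0)}"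
  have "expo ` {\<eta> :: 'n dec. grd \<eta> \<le> N} \<subseteq> ?A"
  proof clarsimp
    fix \<eta> :: "'n dec" and j assume le: "grd \<eta> \<le> N"
    obtain i n where n: "expo \<eta> = (\<lambda>j. int (n j) - ei i j)"
      using expo[of \<eta>] by (auto simp: Hi_def)
    have "int (n j) \<le> (\<Sum>j\<in>UNIV. int (n j))" by (rule member_le_sum) auto
    also have "\<dots> = grd \<eta> + 1" by (simp add: grd_def n(1) ei_def sum_subtractf)
    finally show "- 1 \<le> expo \<eta> j \<and> expo \<eta> j \<le> N + 1" using le by (auto simp: n(1) ei_def)
  qed
  moreover have "finite ?A" by (rule finite_set_of_finite_funs) auto
  ultimately have "finite (expo ` {\<eta> :: 'n dec. grd \<eta> \<le> N})" by (rule finite_subset)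
  then show ?thesis by (rule finite_imageD) (simp add: expo_inject inj_on_def)
qed

lemma finite_gr_le: "finite {F :: 'n::finite forest. gr F \<le> N}"
proof (induction "nat N" arbitrary: N rule: less_induct)
  case less
  show ?case
  proof (cases "N \<ge> 1")
    case True
    let ?T = "{T :: 'n dec rtree. gr_tree T \<le> N}"
    have "?T \<subseteq> case_prod Node ` ({\<eta>. grd \<eta> \<le> N} \<times> {F. gr F \<le> N - 1})"
    proof
      fix T assume T: "T \<in> ?T"
      obtain \<eta> F where [simp]: "T = Node \<eta> F" by (cases T)
      have "grd \<eta> + gr F \<le> N" using T by (simp add: gr_def)
      then have "(\<eta>, F) \<in> {\<eta>. grd \<eta> \<le> N} \<times> {F. gr F \<le> N - 1}"
        using grd_ge_1[of \<eta>] gr_ge_size[of F] by auto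
      then show "T \<in> case_prod Node ` ({\<eta>. grd \<eta> \<le> N} \<times> {F. gr F \<le> N - 1})"
        by (metis (no_types, lifting) \<open>T = Node \<eta> F\<close> case_prod_conv image_eqI)
    qed
    moreover have "finite {F :: 'n forest. gr F \<le> N - 1}" using True by (intro less) auto
    ultimately have fin: "finite ?T"
      by (elim finite_subset) (intro finite_imageI finite_cartesian_product finite_grd_le)
    have "{F :: 'n forest. gr F \<le> N} \<subseteq> mset ` {Ts. set Ts \<subseteq> ?T \<and> length Ts \<le> nat N}"
    proof
      fix F :: "'n forest" assume "F \<in> {F. gr F \<le> N}"
      then have F: "gr F \<le> N" by simp
      obtain Ts where Ts: "mset Ts = F" using ex_mset by blast
      have "gr_tree T \<le> N" if "T \<in># F" for T
      proof -
        from multi_member_split[OF that] obtain G where "F = add_mset T G" by blast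
        then have "gr F = gr_tree T + gr G" by (simp add: gr_def)
        then show ?thesis using F gr_ge_size[of G] by linarith
      qed
      moreover have "length Ts \<le> nat N" using gr_ge_size[of F] F Ts by auto
      ultimately show "F \<in> mset ` {Ts. set Ts \<subseteq> ?T \<and> length Ts \<le> nat N}"
        using Ts by force
    qed
    then show ?thesis using finite_lists_length_le[OF fin] by (meson finite_imageI finite_subset)
  next
    case False
    have "{F :: 'n forest. gr F \<le> N} \<subseteq> {{#}}"
    proof
      fix F :: "'n forest" assume "F \<in> {F. gr F \<le> N}"
      then have "gr F \<le> N" by simp
      then have "size F = 0" using False gr_ge_size[of F] by linarith
      then show "F \<in> {{#}}" by simp
    qed
    then show ?thesis by (rule finite_subset) simp
  qed
qed

definition homog :: "int \<Rightarrow> 'n::finite ck2 set" where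
  "homog k = {z. \<forall>(F, G)\<in>Poly_Mapping.keys z. gr F + gr G = k}"

lemma homog_0: "0 \<in> homog k" and homog_1: "1 \<in> homog 0"
  by (auto simp: homog_def zero_prod_def zero_multiset_def[symmetric])

lemma homog_mult: "y \<in> homog k \<Longrightarrow> z \<in> homog l \<Longrightarrow> y * z \<in> homog (k + l)"
  unfolding homog_def using Poly_Mapping.keys_mult[of y z] by fastforce

lemma homog_add: "y \<in> homog k \<Longrightarrow> z \<in> homog k \<Longrightarrow> y + z \<in> homog k"
  unfolding homog_def using Poly_Mapping.keys_add[of y z] by fast

lemma homog_sum: "(\<And>s. s \<in> S \<Longrightarrow> h s \<in> homog k) \<Longrightarrow> sum h S \<in> homog k"
  by (induction S rule: infinite_finite_induct) (auto intro: homog_add homog_0)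

lemma homog_id_bplus: "z \<in> homog k \<Longrightarrow> id_bplus \<eta> z \<in> homog (grd \<eta> + k)"
  unfolding id_bplus_def by (rule homog_sum) (auto simp: homog_def split: if_splits)

lemma homog_prod_mset:
  "(\<And>T. T \<in># F \<Longrightarrow> h T \<in> homog (g T)) \<Longrightarrow> (\<Prod>T\<in>#F. h T) \<in> homog (\<Sum>T\<in>#F. g T)"
  by (induction F) (auto intro: homog_mult homog_1)

lemma coprod_tree_homog: "coprod_tree T \<in> homog (gr_tree T)"
proof (induction T)
  case (Node \<eta> F)
  have "Poly_Mapping.single (bplus \<eta> F, {#}) 1 \<in> homog (gr_tree (Node \<eta> F))"
    by (simp add: homog_def bplus_def gr_def)
  moreover have "id_bplus \<eta> (\<Prod>T\<in>#F. coprod_tree T) \<in> homog (gr_tree (Node \<eta> F))"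
    using homog_id_bplus[OF homog_prod_mset[OF Node]] by simp
  ultimately show ?case by (simp add: homog_add)
qed

lemma coprod_homog: "coprod (Poly_Mapping.single F 1) \<in> homog (gr F)"
  by (simp add: coprod_single gr_def homog_prod_mset coprod_tree_homog)

text \<open>The graded dual is spanned by the dual basis, is closed under the product, and its coproduct
  takes values in its tensor square.\<close>

lemma ck_dual_add: "\<phi> \<in> ck_dual \<Longrightarrow> \<phi> (v + w) = \<phi> v + \<phi> w"
  and ck_dual_scale: "\<phi> \<in> ck_dual \<Longrightarrow> \<phi> (scale c w) = c * \<phi> w"
  by (simp_all add: ck_dual_def)

lemma ck_dual_single: "\<phi> \<in> ck_dual \<Longrightarrow> \<phi> (Poly_Mapping.single F c) = c * \<phi> (Poly_Mapping.single F 1)"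
  by (metis ck_dual_scale mult.right_neutral scale_single)

lemma ck_dual_0: "\<phi> \<in> ck_dual \<Longrightarrow> \<phi> 0 = 0"
  by (metis ck_dual_scale mult_zero_left scale_0)

lemma ck_dual_sum: "\<phi> \<in> ck_dual \<Longrightarrow> \<phi> (sum h S) = (\<Sum>s\<in>S. \<phi> (h s))"
  by (induction S rule: infinite_finite_induct) (auto simp: ck_dual_0 ck_dual_add)

lemma finite_supp_ck_dual:
  assumes "\<phi> \<in> ck_dual"
  shows "finite {F. \<phi> (Poly_Mapping.single F 1) \<noteq> 0}"
proof -
  obtain N where "\<And>F. gr F > N \<Longrightarrow> \<phi> (Poly_Mapping.single F 1) = 0"
    using assms by (auto simp: ck_dual_def)
  then have "{F. \<phi> (Poly_Mapping.single F 1) \<noteq> 0} \<subseteq> {F. gr F \<le> N}"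
    by (auto simp: not_less[symmetric])
  then show ?thesis using finite_gr_le finite_subset by blast
qed

lemma dual_basis_in_ck_dual: "dual_basis F \<in> ck_dual"
  by (auto simp: ck_dual_def dual_basis_def lookup_add lookup_single when_def intro!: exI[of _ "gr F"])

lemma ck_dual_eq_sum_dual_basis:
  assumes "\<phi> \<in> ck_dual"
  shows "\<phi> w = (\<Sum>F | \<phi> (Poly_Mapping.single F 1) \<noteq> 0. \<phi> (Poly_Mapping.single F 1) * dual_basis F w)"
proof -
  let ?c = "\<lambda>F. \<phi> (Poly_Mapping.single F 1) * dual_basis F w"
  have "\<phi> w = (\<Sum>F\<in>Poly_Mapping.keys w. ?c F)"
    by (subst sum_singles[of w])
      (simp add: ck_dual_sum[OF assms] ck_dual_single[OF assms, of _ "Poly_Mapping.lookup w _"]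
        dual_basis_def mult.commute)
  also have "\<dots> = (\<Sum>F\<in>Poly_Mapping.keys w \<union> {F. \<phi> (Poly_Mapping.single F 1) \<noteq> 0}. ?c F)"
    using finite_supp_ck_dual[OF assms]
    by (intro sum.mono_neutral_left) (auto simp: dual_basis_def in_keys_iff)
  also have "\<dots> = (\<Sum>F | \<phi> (Poly_Mapping.single F 1) \<noteq> 0. ?c F)"
    using finite_supp_ck_dual[OF assms] by (intro sum.mono_neutral_right) auto
  finally show ?thesis .
qed

lemma coarb_dual_basis: "coarb \<rho> (dual_basis F) = coarb_forest \<rho> F"
proof -
  have [simp]: "const 1 = (1 :: 'a mps)" by (simp add: const_def one_mps_def)
  have "{G. dual_basis F (Poly_Mapping.single G 1) \<noteq> 0} = {F}"
    by (auto simp: dual_basis_def lookup_single when_def)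
  then show ?thesis by (auto simp: coarb_def dual_basis_def fun_eq_iff)
qed

lemma tensor_add: "tensor \<phi> \<psi> (y + z) = tensor \<phi> \<psi> y + tensor \<phi> \<psi> z"
  using sum_keys_add[of "\<lambda>k c. c * \<phi> (Poly_Mapping.single (fst k) 1) * \<psi> (Poly_Mapping.single (snd k) 1)" y z]
  by (simp add: tensor_def split_beta algebra_simps)

lemma tensor_scale: "tensor \<phi> \<psi> (scale c z) = c * tensor \<phi> \<psi> z"
proof (cases "c = 0")
  case False
  then have "Poly_Mapping.keys (scale c z) = Poly_Mapping.keys z" by (auto simp: in_keys_iff)
  then show ?thesis by (simp add: tensor_def split_beta sum_distrib_left mult.assoc)
qed (simp add: tensor_def)

lemma dual_mult_in_ck_dual:
  assumes "\<phi> \<in> ck_dual" "\<psi> \<in> ck_dual"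
  shows "dual_mult \<phi> \<psi> \<in> ck_dual"
proof -
  obtain M N where M: "\<And>F. gr F > M \<Longrightarrow> \<phi> (Poly_Mapping.single F 1) = 0"
    and N: "\<And>F. gr F > N \<Longrightarrow> \<psi> (Poly_Mapping.single F 1) = 0"
    using assms by (auto simp: ck_dual_def)
  have "dual_mult \<phi> \<psi> (Poly_Mapping.single K 1) = 0" if "gr K > M + N" for K
    unfolding dual_mult_def tensor_def
  proof (rule sum.neutral, clarify)
    fix F G assume "(F, G) \<in> Poly_Mapping.keys (coprod (Poly_Mapping.single K (1 :: complex)))"
    then have "gr F + gr G = gr K" using coprod_homog[of K] by (auto simp: homog_def)
    with that have "gr F > M \<or> gr G > N" by linarith
    then show "Poly_Mapping.lookup (coprod (Poly_Mapping.single K 1)) (F, G) *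
        \<phi> (Poly_Mapping.single F 1) * \<psi> (Poly_Mapping.single G 1) = 0"
      using M N by auto
  qed
  then show ?thesis
    by (auto simp: ck_dual_def dual_mult_def coprod_add coprod_scale tensor_add tensor_scale)
qed

lemma dual_coprod_decomposition:
  fixes D :: "'n::finite functional"
  assumes D: "D \<in> ck_dual"
  obtains DD :: "('n functional \<times> 'n functional) list"
  where "set DD \<subseteq> ck_dual \<times> ck_dual" "dual_coprod D = (\<lambda>z. \<Sum>(D1, D2)\<leftarrow>DD. tensor D1 D2 z)"
proof -
  define d where "d F G = D (Poly_Mapping.single (F + G) 1)" for F G
  define S where "S = {(F, G). d F G \<noteq> 0}"
  obtain N where N: "\<And>F. gr F > N \<Longrightarrow> D (Poly_Mapping.single F 1) = 0"
    using D by (auto simp: ck_dual_def)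
  have "S \<subseteq> {F. gr F \<le> N} \<times> {G. gr G \<le> N}"
  proof clarsimp
    fix F G assume "(F, G) \<in> S"
    then have "gr F + gr G \<le> N" using N[of "F + G"] by (auto simp: S_def d_def not_less[symmetric])
    then show "gr F \<le> N \<and> gr G \<le> N" using gr_ge_size[of F] gr_ge_size[of G] by auto
  qed
  then have finS: "finite S" using finite_gr_le finite_subset by blast
  then obtain ps where ps: "set ps = S" "distinct ps" using finite_distinct_list by blast
  define DD where "DD = map (\<lambda>(F, G). ((\<lambda>w. d F G * dual_basis F w), dual_basis G)) ps"
  have in_dual: "(\<lambda>w. c * dual_basis F w) \<in> ck_dual" for c and F :: "'n forest"
    using dual_basis_in_ck_dual[of F] by (auto simp: ck_dual_def algebra_simps)
  have "set DD \<subseteq> ck_dual \<times> ck_dual"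
    using in_dual dual_basis_in_ck_dual by (auto simp: DD_def)
  moreover have "dual_coprod D z = (\<Sum>(D1, D2)\<leftarrow>DD. tensor D1 D2 z)" for z
  proof -
    have t: "tensor (\<lambda>w. d F G * dual_basis F w) (dual_basis G) z = d F G * Poly_Mapping.lookup z (F, G)" for F G
    proof -
      have "tensor (\<lambda>w. d F G * dual_basis F w) (dual_basis G) z =
        (\<Sum>k\<in>Poly_Mapping.keys z. if k = (F, G) then d F G * Poly_Mapping.lookup z (F, G) else 0)"
        unfolding tensor_def
        by (rule sum.cong) (auto simp: dual_basis_def lookup_single when_def split: if_splits)
      also have "\<dots> = d F G * Poly_Mapping.lookup z (F, G)" by (simp add: in_keys_iff)
      finally show ?thesis .
    qed
    have "dual_coprod D z = (\<Sum>(F, G)\<in>Poly_Mapping.keys z. d F G * Poly_Mapping.lookup z (F, G))"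
      unfolding dual_coprod_def mult_ck_def ck_dual_sum[OF D]
      by (rule sum.cong)
        (auto simp: d_def ck_dual_single[OF D, of _ "Poly_Mapping.lookup z _"])
    also have "\<dots> = (\<Sum>(F, G)\<in>Poly_Mapping.keys z \<union> S. d F G * Poly_Mapping.lookup z (F, G))"
      using finS by (intro sum.mono_neutral_left) (auto simp: in_keys_iff)
    also have "\<dots> = (\<Sum>(F, G)\<in>S. d F G * Poly_Mapping.lookup z (F, G))"
      using finS by (intro sum.mono_neutral_right) (auto simp: S_def)
    also have "\<dots> = (\<Sum>(F, G)\<leftarrow>ps. d F G * Poly_Mapping.lookup z (F, G))"
      using ps by (simp add: sum_list_distinct_conv_sum_set)
    also have "\<dots> = (\<Sum>(D1, D2)\<leftarrow>DD. tensor D1 D2 z)"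
      by (simp add: DD_def t o_def case_prod_unfold)
    finally show ?thesis .
  qed
  ultimately show ?thesis using that[of DD] by blast
qed

end

theory Submission
  imports Defs
begin

text \<open>Write \<open>E\<^sub>F\<close> for the operator of the forest \<open>F\<close>. Everything follows from two expansions, one of
  \<open>E\<^sub>F (u v)\<close> and one of \<open>E\<^sub>F (E\<^sub>G u)\<close>; the statements about arbitrary elements of the graded dual are
  their finite linear combinations.

  Products. By definition \<open>E\<^sub>F u\<close> is the coefficient of the monomial \<open>F\<close> in the Taylor expansion of
  \<open>u\<close> at \<open>x + \<Sum>\<^sub>T t\<^sub>T E\<^sub>T x\<close>, where the \<open>t\<^sub>T\<close> are commuting parameters indexed by the trees. Since
  this is a substitution, \<open>u \<mapsto> (E\<^sub>F u)\<^sub>F\<close> is multiplicative: \<open>E\<^sub>K (u v)\<close> is the sum of the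
  \<open>E\<^sub>F u * E\<^sub>G v\<close> over \<open>F + G = K\<close> (\<open>coarb_forest_mult\<close>), and this is the compatibility with the
  coproduct of the dual. The substitution itself never appears: the proof differentiates the
  expansion with respect to one \<open>t\<^sub>T\<close> (\<open>coarb_forest_add_mset\<close>), which turns the symmetry factors
  into multiplicities and the claim into the Leibniz rule.

  Composition. The claim is \<open>E\<^sub>F (E\<^sub>G u) = \<Sum>\<^sub>K cut K F G * E\<^sub>K u\<close> (\<open>coarb_forest_comp\<close>), where
  \<open>cut K F G\<close> is the coefficient of \<open>F \<otimes> G\<close> in the coproduct of \<open>K\<close>. Both sides, as families
  indexed by \<open>(F, G)\<close>, are multiplicative in \<open>u\<close>: the left one because each of its two factors is,
  the right one because the coproduct of \<open>CK\<^sub>H\<close> is a morphism of algebras (\<open>cut_expansion_mult\<close>).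
  Both sides are also linear and continuous, so it is enough to take for \<open>u\<close> a variable
  (\<open>cut_expansion_var\<close>). Then forests of two or more trees contribute nothing, and for a tree
  \<open>G = B\<^sup>+(G')\<close> with root \<open>\<eta>\<close> the recursive definitions of the coproduct and of \<open>E\<^sub>G\<close> reduce the
  claim to the one for \<open>G'\<close> and the series \<open>\<rho> \<eta> x\<^sub>i\<close>. This is an induction on the degree of \<open>G\<close>.\<close>

section \<open>Constants, derivatives and monomials\<close>

lemma coeff_simps [simp]:
  "coeff 0 \<alpha> = 0" "coeff (u + v) \<alpha> = coeff u \<alpha> + coeff v \<alpha>"
  "coeff (u - v) \<alpha> = coeff u \<alpha> - coeff v \<alpha>"
  by (simp_all add: zero_mps_def plus_mps_def minus_mps_def)

lemma coeff_sum: "coeff (sum h S) \<alpha> = (\<Sum>s\<in>S. coeff (h s) \<alpha>)"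
  by (induction S rule: infinite_finite_induct) auto

lemma const_0 [simp]: "const 0 = 0" and const_1 [simp]: "const 1 = 1"
  by (auto simp: const_def zero_mps_def one_mps_def)

lemma const_add: "const (c + d) = const c + const d"
  by (rule mps_eqI) (simp add: const_def)

lemma const_mult: "const (c * d) = const c * (const d :: 'n::finite mps)"
  by (rule mps_eqI) (simp add: coeff_const_mult, simp add: const_def)

lemma const_sum: "const (sum h S) = (\<Sum>s\<in>S. const (h s))"
  by (induction S rule: infinite_finite_induct) (auto simp: const_add)

lemma pd_add: "pd i (u + v) = pd i u + pd i v"
  by (rule mps_eqI) (simp add: pd_def algebra_simps)

lemma pd_const_mult: "pd i (const c * u) = const c * pd i u"
  by (rule mps_eqI) (simp add: coeff_const_mult pd_def mult.left_commute)

lemma pd_1: "pd i 1 = 0"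
  by (rule mps_eqI) (auto simp: pd_def one_mps_def fun_eq_iff intro: exI[of _ i])

lemma pd_var: "pd i (var k) = (if i = k then 1 else 0)"
proof (rule mps_eqI)
  fix \<alpha> :: "'a \<Rightarrow> nat"
  have "\<alpha>(i := \<alpha> i + 1) = (\<lambda>j. if j = k then 1 else 0) \<longleftrightarrow> i = k \<and> \<alpha> = (\<lambda>j. 0)" (is "?f = ?g \<longleftrightarrow> _")
  proof
    assume eq: "?f = ?g"
    have "i = k" using fun_cong[OF eq, of i] by (auto split: if_splits)
    moreover have "\<alpha> j = 0" for j using fun_cong[OF eq, of j] \<open>i = k\<close> by (simp split: if_splits)
    ultimately show "i = k \<and> \<alpha> = (\<lambda>j. 0)" by blast
  qed auto
  then show "coeff (pd i (var k)) \<alpha> = coeff (if i = k then 1 else 0) \<alpha>"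
    by (simp add: pd_def var_def one_mps_def)
qed

lemma pd_mult: "pd i (u * v) = pd i u * v + u * pd i (v :: 'n::finite mps)"
proof (rule mps_eqI)
  fix \<alpha> :: "'n \<Rightarrow> nat"
  let ?\<alpha> = "\<alpha>(i := \<alpha> i + 1)"
  have half: "(\<Sum>(\<beta>, \<gamma>)\<in>splits ?\<alpha>. of_nat (\<beta> i) * coeff f \<beta> * coeff g \<gamma>) = coeff (pd i f * g) \<alpha>"
    for f g :: "'n mps"
  proof -
    have down: "(\<beta>(i := \<beta> i - 1), \<gamma>) \<in> splits \<alpha>" if "(\<beta>, \<gamma>) \<in> splits ?\<alpha>" "\<beta> i \<noteq> 0" for \<beta> \<gamma>
    proof -
      have "?\<alpha> j = \<beta> j + \<gamma> j" for j
        using that(1) unfolding splits_def by (auto dest: fun_cong[of _ _ j])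
      from this[of i] this have "\<alpha> j = (\<beta>(i := \<beta> i - 1)) j + \<gamma> j" for j
        using that(2) by (cases "j = i") (auto split: if_splits, metis)
      then show ?thesis by (auto simp: splits_def)
    qed
    have up: "(\<beta>(i := \<beta> i + 1), \<gamma>) \<in> splits ?\<alpha>" if "(\<beta>, \<gamma>) \<in> splits \<alpha>" for \<beta> \<gamma>
      using that by (auto simp: splits_def)
    have "coeff (pd i f * g) \<alpha> =
        (\<Sum>(\<beta>, \<gamma>)\<in>{p \<in> splits ?\<alpha>. fst p i \<noteq> 0}. of_nat (\<beta> i) * coeff f \<beta> * coeff g \<gamma>)"
      unfolding times_mps_def coeff_Series
      by (rule sum.reindex_bij_witness[where
            i = "\<lambda>(\<beta>, \<gamma>). (\<beta>(i := \<beta> i - 1), \<gamma>)" and j = "\<lambda>(\<beta>, \<gamma>). (\<beta>(i := \<beta> i + 1), \<gamma>)"])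
        (use up down in \<open>auto simp: pd_def\<close>)
    also have "\<dots> = (\<Sum>(\<beta>, \<gamma>)\<in>splits ?\<alpha>. of_nat (\<beta> i) * coeff f \<beta> * coeff g \<gamma>)"
      by (rule sum.mono_neutral_left) auto
    finally show ?thesis by simp
  qed
  have swap: "(\<Sum>(\<beta>, \<gamma>)\<in>splits ?\<alpha>. of_nat (\<gamma> i) * coeff u \<beta> * coeff v \<gamma>)
      = (\<Sum>(\<beta>, \<gamma>)\<in>splits ?\<alpha>. of_nat (\<beta> i) * coeff v \<beta> * coeff u \<gamma>)"
    by (rule sum.reindex_bij_witness[where i = prod.swap and j = prod.swap])
      (auto simp: splits_def add.commute)
  have "coeff (pd i (u * v)) \<alpha> = (\<Sum>(\<beta>, \<gamma>)\<in>splits ?\<alpha>. of_nat (?\<alpha> i) * coeff u \<beta> * coeff v \<gamma>)"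
    by (simp add: pd_def times_mps_def sum_distrib_left split_beta mult.assoc)
  also have "\<dots> = (\<Sum>(\<beta>, \<gamma>)\<in>splits ?\<alpha>. of_nat (\<beta> i) * coeff u \<beta> * coeff v \<gamma>) +
      (\<Sum>(\<beta>, \<gamma>)\<in>splits ?\<alpha>. of_nat (\<gamma> i) * coeff u \<beta> * coeff v \<gamma>)"
    unfolding sum.distrib[symmetric]
  proof (intro sum.cong refl, clarify)
    fix \<beta> \<gamma> assume "(\<beta>, \<gamma>) \<in> splits ?\<alpha>"
    then have "?\<alpha> i = \<beta> i + \<gamma> i" by (simp only: splits_def mem_Collect_eq case_prod_conv)
    then show "of_nat (?\<alpha> i) * coeff u \<beta> * coeff v \<gamma> =
        of_nat (\<beta> i) * coeff u \<beta> * coeff v \<gamma> + of_nat (\<gamma> i) * coeff u \<beta> * coeff v \<gamma>"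
      by (simp only: of_nat_add distrib_right)
  qed
  finally show "coeff (pd i (u * v)) \<alpha> = coeff (pd i u * v + u * pd i v) \<alpha>"
    by (simp only: coeff_simps swap half mult.commute[of u "pd i v"])
qed

lemma coeff_var_mult:
  "coeff (var i * (u :: 'n::finite mps)) \<alpha> = (if \<alpha> i = 0 then 0 else coeff u (\<alpha>(i := \<alpha> i - 1)))"
proof -
  let ?e = "\<lambda>j. if j = i then 1 else 0 :: nat"
  let ?S = "if \<alpha> i = 0 then {} else {(?e, \<alpha>(i := \<alpha> i - 1))}"
  have "coeff (var i * u) \<alpha> = (\<Sum>(\<beta>, \<gamma>)\<in>?S. coeff (var i) \<beta> * coeff u \<gamma>)"
    unfolding times_mps_def coeff_Series
  proof (rule sum.mono_neutral_right[OF finite_splits])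
    show "?S \<subseteq> splits \<alpha>" by (auto simp: splits_def)
    show "\<forall>p\<in>splits \<alpha> - ?S. (case p of (\<beta>, \<gamma>) \<Rightarrow> coeff (var i) \<beta> * coeff u \<gamma>) = 0"
    proof clarify
      fix \<beta> \<gamma> assume s: "(\<beta>, \<gamma>) \<in> splits \<alpha>" "(\<beta>, \<gamma>) \<notin> ?S"
      have "\<beta> \<noteq> ?e"
      proof
        assume b: "\<beta> = ?e"
        with s(1) have "\<alpha> i \<noteq> 0" "\<gamma> = \<alpha>(i := \<alpha> i - 1)"
          by (auto simp: splits_def)
        with b s(2) show False by simp
      qed
      then show "coeff (var i) \<beta> * coeff u \<gamma> = 0" by (simp add: var_def)
    qed
  qed
  then show ?thesis by (simp add: var_def)
qed

text \<open>The monomials with exponents in \<open>\<nat>\<^sup>\<nu>\<close>; all series are limits of their combinations.\<close>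

definition xmono :: "('n \<Rightarrow> nat) \<Rightarrow> 'n mps" where
  "xmono \<beta> = Series (\<lambda>\<alpha>. if \<alpha> = \<beta> then 1 else 0)"

lemma xmono_induct:
  fixes P :: "'n::finite mps \<Rightarrow> bool"
  assumes "P 1" "\<And>i. P (var i)" "\<And>u v. P u \<Longrightarrow> P v \<Longrightarrow> P (u * v)"
  shows "P (xmono \<beta>)"
proof (induction "\<Sum>j\<in>UNIV. \<beta> j" arbitrary: \<beta>)
  case 0
  then have "\<beta> = (\<lambda>j. 0)" by (auto simp: fun_eq_iff)
  then show ?case using assms(1) by (simp add: xmono_def one_mps_def)
next
  case (Suc n)
  then obtain i where i: "\<beta> i \<noteq> 0" by (metis sum.neutral nat.distinct(1))
  let ?\<beta> = "\<beta>(i := \<beta> i - 1)"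
  have "(\<Sum>j\<in>UNIV. \<beta> j) = \<beta> i + (\<Sum>j\<in>UNIV - {i}. \<beta> j)"
    and "(\<Sum>j\<in>UNIV. ?\<beta> j) = \<beta> i - 1 + (\<Sum>j\<in>UNIV - {i}. \<beta> j)"
    by (simp_all add: sum.remove[of _ i])
  then have "n = (\<Sum>j\<in>UNIV. ?\<beta> j)" using Suc(2) i by linarith
  then have "P (var i * xmono ?\<beta>)" using Suc(1) assms by blast
  also have "var i * xmono ?\<beta> = xmono \<beta>"
  proof (rule mps_eqI)
    fix \<alpha> :: "'n \<Rightarrow> nat"
    have "\<alpha> = \<beta>" if "\<alpha>(i := \<alpha> i - 1) = ?\<beta>" "\<alpha> i \<noteq> 0"
    proof
      show "\<alpha> j = \<beta> j" for j
        using fun_cong[OF that(1), of j] that(2) i by (cases "j = i") auto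
    qed
    then show "coeff (var i * xmono ?\<beta>) \<alpha> = coeff (xmono \<beta>) \<alpha>"
      using i by (auto simp: coeff_var_mult xmono_def simp del: One_nat_def)
  qed
  finally show ?case .
qed


section \<open>Continuous linear operators\<close>

text \<open>Continuity is for the topology in which a series is small when its coefficients of low degree
  vanish: a coefficient of \<open>L u\<close> only depends on finitely many coefficients of \<open>u\<close>.\<close>

definition continuous_linear :: "'n::finite operator \<Rightarrow> bool" where
  "continuous_linear L \<longleftrightarrow> (\<forall>u v. L (u + v) = L u + L v) \<and> (\<forall>c u. L (const c * u) = const c * L u) \<and>
     (\<forall>\<alpha>. \<exists>N. \<forall>u. (\<forall>\<beta>. (\<Sum>j\<in>UNIV. \<beta> j) \<le> N \<longrightarrow> coeff u \<beta> = 0) \<longrightarrow> coeff (L u) \<alpha> = 0)"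

lemma continuous_linearD:
  assumes "continuous_linear L"
  shows continuous_linear_add: "L (u + v) = L u + L v"
    and continuous_linear_const: "L (const c * u) = const c * L u"
    and continuous_linear_0: "L 0 = 0"
    and continuous_linear_sum: "L (sum h S) = (\<Sum>s\<in>S. L (h s))"
proof -
  show add: "L (u + v) = L u + L v" for u v using assms by (simp add: continuous_linear_def)
  show "L (const c * u) = const c * L u" for c u using assms by (simp add: continuous_linear_def)
  from this[of 0] show 0: "L 0 = 0" by simp
  show "L (sum h S) = (\<Sum>s\<in>S. L (h s))"
    by (induction S rule: infinite_finite_induct) (auto simp: 0 add)
qed

lemma continuous_linear_modulus:
  assumes "continuous_linear L"
  obtains N where "\<And>u. (\<And>\<beta>. (\<Sum>j\<in>UNIV. \<beta> j) \<le> N \<Longrightarrow> coeff u \<beta> = 0) \<Longrightarrow> coeff (L u) \<alpha> = 0"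
  using assms unfolding continuous_linear_def by meson

lemma continuous_linearI:
  assumes "\<And>u v. L (u + v) = L u + L v" "\<And>c u. L (const c * u) = const c * L u"
    and "\<And>\<alpha>. \<exists>N. \<forall>u. (\<forall>\<beta>. (\<Sum>j\<in>UNIV. \<beta> j) \<le> N \<longrightarrow> coeff u \<beta> = 0) \<longrightarrow> coeff (L u) \<alpha> = 0"
  shows "continuous_linear L"
  using assms by (simp add: continuous_linear_def)

lemma continuous_linear_comp:
  fixes L M :: "'n::finite operator"
  assumes L: "continuous_linear L" and M: "continuous_linear M"
  shows "continuous_linear (\<lambda>u. L (M u))"
proof (rule continuous_linearI)
  fix \<alpha> :: "'n \<Rightarrow> nat"
  obtain N where N: "\<And>u. (\<And>\<beta>. (\<Sum>j\<in>UNIV. \<beta> j) \<le> N \<Longrightarrow> coeff u \<beta> = 0) \<Longrightarrow> coeff (L u) \<alpha> = 0"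
    using continuous_linear_modulus[OF L] by blast
  have "\<exists>m. \<forall>u. (\<forall>\<gamma>. (\<Sum>j\<in>UNIV. \<gamma> j) \<le> m \<longrightarrow> coeff u \<gamma> = 0) \<longrightarrow> coeff (M u) \<beta> = 0" for \<beta>
    using M by (simp add: continuous_linear_def)
  then obtain m where m: "\<And>\<beta> u. (\<And>\<gamma>. (\<Sum>j\<in>UNIV. \<gamma> j) \<le> m \<beta> \<Longrightarrow> coeff u \<gamma> = 0) \<Longrightarrow> coeff (M u) \<beta> = 0"
    by metis
  define B where "B = (\<Sum>\<beta> | (\<Sum>j\<in>UNIV. \<beta> j) \<le> N. m \<beta>)"
  have mB: "m \<beta> \<le> B" if "(\<Sum>j\<in>UNIV. \<beta> j) \<le> N" for \<beta>
    unfolding B_def by (rule member_le_sum) (use that finite_degree_le in auto)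
  have "coeff (L (M u)) \<alpha> = 0" if "\<And>\<gamma>. (\<Sum>j\<in>UNIV. \<gamma> j) \<le> B \<Longrightarrow> coeff u \<gamma> = 0" for u
    by (rule N, rule m, rule that) (use mB le_trans in blast)
  then show "\<exists>N. \<forall>u. (\<forall>\<beta>. (\<Sum>j\<in>UNIV. \<beta> j) \<le> N \<longrightarrow> coeff u \<beta> = 0) \<longrightarrow> coeff (L (M u)) \<alpha> = 0"
    by blast
qed (simp_all add: continuous_linearD[OF L] continuous_linearD[OF M])

lemma continuous_linear_mult: "continuous_linear (\<lambda>u. p * u)"
proof (rule continuous_linearI)
  fix \<alpha> :: "'a \<Rightarrow> nat"
  have "coeff (p * u) \<alpha> = 0" if "\<forall>\<beta>. (\<Sum>j\<in>UNIV. \<beta> j) \<le> (\<Sum>j\<in>UNIV. \<alpha> j) \<longrightarrow> coeff u \<beta> = 0" for u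
    unfolding times_mps_def coeff_Series
    by (rule sum.neutral) (auto simp: splits_def that sum_mono)
  then show "\<exists>N. \<forall>u. (\<forall>\<beta>. (\<Sum>j\<in>UNIV. \<beta> j) \<le> N \<longrightarrow> coeff u \<beta> = 0) \<longrightarrow> coeff (p * u) \<alpha> = 0"
    by blast
qed (simp_all add: algebra_simps)

lemma continuous_linear_pd: "continuous_linear (pd i)"
proof (rule continuous_linearI)
  fix \<alpha> :: "'a \<Rightarrow> nat"
  show "\<exists>N. \<forall>u. (\<forall>\<beta>. (\<Sum>j\<in>UNIV. \<beta> j) \<le> N \<longrightarrow> coeff u \<beta> = 0) \<longrightarrow> coeff (pd i u) \<alpha> = 0"
    by (rule exI[of _ "\<Sum>j\<in>UNIV. (\<alpha>(i := \<alpha> i + 1)) j"]) (simp add: pd_def del: fun_upd_apply)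
qed (simp_all add: pd_add pd_const_mult)

lemma continuous_linear_pds: "continuous_linear (pds is)"
proof (induction "is")
  case Nil
  have "pds [] = (\<lambda>u. 1 * u)" by (auto simp: pds_def)
  then show ?case using continuous_linear_mult by metis
next
  case (Cons i "is")
  have "pds (i # is) = (\<lambda>u. pd i (pds is u))" by (auto simp: pds_def)
  then show ?case using continuous_linear_comp[OF continuous_linear_pd Cons] by metis
qed

lemma continuous_linear_zero: "continuous_linear (\<lambda>u. 0)"
  using continuous_linear_mult[of 0] by simp

lemma continuous_linear_plus:
  fixes L M :: "'n::finite operator"
  assumes L: "continuous_linear L" and M: "continuous_linear M"
  shows "continuous_linear (\<lambda>u. L u + M u)"
proof (rule continuous_linearI)
  fix \<alpha> :: "'n \<Rightarrow> nat"
  obtain m n where "\<And>u. (\<And>\<beta>. (\<Sum>j\<in>UNIV. \<beta> j) \<le> m \<Longrightarrow> coeff u \<beta> = 0) \<Longrightarrow> coeff (L u) \<alpha> = 0"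
    and "\<And>u. (\<And>\<beta>. (\<Sum>j\<in>UNIV. \<beta> j) \<le> n \<Longrightarrow> coeff u \<beta> = 0) \<Longrightarrow> coeff (M u) \<alpha> = 0"
    using continuous_linear_modulus[OF L] continuous_linear_modulus[OF M] by metis
  then show "\<exists>N. \<forall>u. (\<forall>\<beta>. (\<Sum>j\<in>UNIV. \<beta> j) \<le> N \<longrightarrow> coeff u \<beta> = 0) \<longrightarrow> coeff (L u + M u) \<alpha> = 0"
    by (intro exI[of _ "max m n"]) (simp add: le_max_iff_disj)
qed (simp_all add: continuous_linearD[OF L] continuous_linearD[OF M] distrib_left add_ac)

lemma continuous_linear_sum_family:
  "(\<And>s. s \<in> S \<Longrightarrow> continuous_linear (h s)) \<Longrightarrow> continuous_linear (\<lambda>u. \<Sum>s\<in>S. h s u)"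
  by (induction S rule: infinite_finite_induct) (auto intro: continuous_linear_zero continuous_linear_plus)

text \<open>Polynomials are dense: a given coefficient of the images of \<open>u\<close> only sees a truncation of \<open>u\<close>,
  which is a combination of monomials.\<close>

lemma continuous_linear_eqI:
  fixes L M :: "'n::finite operator"
  assumes L: "continuous_linear L" and M: "continuous_linear M"
    and eq: "\<And>\<beta>. L (xmono \<beta>) = M (xmono \<beta>)"
  shows "L u = M u"
proof (rule mps_eqI)
  fix \<alpha>
  obtain m n where m: "\<And>u. (\<And>\<beta>. (\<Sum>j\<in>UNIV. \<beta> j) \<le> m \<Longrightarrow> coeff u \<beta> = 0) \<Longrightarrow> coeff (L u) \<alpha> = 0"
    and n: "\<And>u. (\<And>\<beta>. (\<Sum>j\<in>UNIV. \<beta> j) \<le> n \<Longrightarrow> coeff u \<beta> = 0) \<Longrightarrow> coeff (M u) \<alpha> = 0"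
    using continuous_linear_modulus[OF L] continuous_linear_modulus[OF M] by metis
  let ?B = "{\<beta> :: 'n \<Rightarrow> nat. (\<Sum>j\<in>UNIV. \<beta> j) \<le> max m n}"
  define t where "t = (\<Sum>\<beta>\<in>?B. const (coeff u \<beta>) * xmono \<beta>)"
  have t: "coeff t \<beta> = coeff u \<beta>" if "\<beta> \<in> ?B" for \<beta>
    using that sum.delta'[OF finite_degree_le, of \<beta> "coeff u" "max m n"]
    by (simp add: t_def coeff_sum coeff_const_mult xmono_def if_distrib cong: if_cong)
  have "L t = M t"
    by (simp add: t_def continuous_linearD[OF L] continuous_linearD[OF M] eq)
  moreover have "coeff (L (u - t)) \<alpha> = 0" "coeff (M (u - t)) \<alpha> = 0"
    by (rule m n; simp add: t le_max_iff_disj)+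
  moreover have "L u = L t + L (u - t)" "M u = M t + M (u - t)"
    by (simp_all flip: continuous_linear_add[OF L] continuous_linear_add[OF M])
  ultimately show "coeff (L u) \<alpha> = coeff (M u) \<alpha>" by simp
qed


section \<open>Differential operators with polynomial coefficients\<close>

lemma is_polynomial_0: "is_polynomial 0" and is_polynomial_1: "is_polynomial 1"
  and is_polynomial_add: "is_polynomial u \<Longrightarrow> is_polynomial v \<Longrightarrow> is_polynomial (u + v)"
  and is_polynomial_xpow: "is_polynomial (xpow m)"
proof -
  show "is_polynomial 0" "is_polynomial 1"
    by (auto simp: is_polynomial_def one_mps_def)
  show "is_polynomial (u + v)" if "is_polynomial u" "is_polynomial v"
  proof -
    have "{\<alpha>. coeff (u + v) \<alpha> \<noteq> 0} \<subseteq> {\<alpha>. coeff u \<alpha> \<noteq> 0} \<union> {\<alpha>. coeff v \<alpha> \<noteq> 0}" by auto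
    then show ?thesis using that finite_subset unfolding is_polynomial_def by blast
  qed
  have "\<alpha> = (\<lambda>j. nat (m j))" if "(\<lambda>j. int (\<alpha> j)) = m" for \<alpha> using that by auto
  then have "{\<alpha>. coeff (xpow m) \<alpha> \<noteq> 0} \<subseteq> {\<lambda>j. nat (m j)}" by (auto simp: xpow_def)
  then show "is_polynomial (xpow m)" using finite_subset unfolding is_polynomial_def by blast
qed

lemma is_polynomial_sum: "(\<And>s. s \<in> S \<Longrightarrow> is_polynomial (h s)) \<Longrightarrow> is_polynomial (sum h S)"
  by (induction S rule: infinite_finite_induct) (auto intro: is_polynomial_0 is_polynomial_add)

lemma is_polynomial_mult:
  assumes "is_polynomial u" "is_polynomial v"
  shows "is_polynomial (u * v)"
proof -
  have "{\<alpha>. coeff (u * v) \<alpha> \<noteq> 0} \<subseteq>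
      (\<lambda>(\<beta>, \<gamma>) j. \<beta> j + \<gamma> j) ` ({\<beta>. coeff u \<beta> \<noteq> 0} \<times> {\<gamma>. coeff v \<gamma> \<noteq> 0})"
  proof
    fix \<alpha> assume "\<alpha> \<in> {\<alpha>. coeff (u * v) \<alpha> \<noteq> 0}"
    then obtain \<beta> \<gamma> where "(\<beta>, \<gamma>) \<in> splits \<alpha>" "coeff u \<beta> * coeff v \<gamma> \<noteq> 0"
      by (auto simp: times_mps_def elim!: sum.not_neutral_contains_not_neutral)
    then show "\<alpha> \<in> (\<lambda>(\<beta>, \<gamma>) j. \<beta> j + \<gamma> j) ` ({\<beta>. coeff u \<beta> \<noteq> 0} \<times> {\<gamma>. coeff v \<gamma> \<noteq> 0})"
      by (auto simp: splits_def intro!: image_eqI[of _ _ "(\<beta>, \<gamma>)"])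
  qed
  then show ?thesis using assms finite_subset unfolding is_polynomial_def by blast
qed

lemma is_polynomial_const: "is_polynomial (const c)"
proof -
  have "{\<alpha>. coeff (const c) \<alpha> \<noteq> 0} \<subseteq> {\<lambda>j. 0}" by (auto simp: const_def)
  then show ?thesis using finite_subset unfolding is_polynomial_def by blast
qed

lemma is_polynomial_pds: "is_polynomial u \<Longrightarrow> is_polynomial (pds is u)"
proof (induction "is")
  case (Cons i "is")
  let ?v = "pds is u"
  have "{\<alpha>. coeff (pd i ?v) \<alpha> \<noteq> 0} \<subseteq> (\<lambda>\<beta>. \<beta>(i := \<beta> i - 1)) ` {\<beta>. coeff ?v \<beta> \<noteq> 0}"
    by (auto simp: pd_def intro!: image_eqI[where x = "_(i := Suc (_ i))"])
  then have "is_polynomial (pd i ?v)"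
    using Cons finite_subset unfolding is_polynomial_def by blast
  then show ?case by (simp add: pds_def)
qed (simp add: pds_def)

lemma diff_ops_term: "is_polynomial p \<Longrightarrow> (\<lambda>u. p * pds is u) \<in> diff_ops"
  unfolding diff_ops_def by (intro CollectI exI[of _ "{is}"] exI[of _ "\<lambda>_. p"]) auto

lemma diff_ops_zero: "(\<lambda>u. 0) \<in> diff_ops"
  using diff_ops_term[OF is_polynomial_0] by simp

lemma diff_ops_add:
  assumes "A \<in> diff_ops" "B \<in> diff_ops"
  shows "(\<lambda>u. A u + B u) \<in> diff_ops"
proof -
  obtain S p where A: "A = (\<lambda>u. \<Sum>is\<in>S. p is * pds is u)" "finite S" "\<forall>is\<in>S. is_polynomial (p is)"
    using assms(1) by (auto simp: diff_ops_def)
  obtain R q where B: "B = (\<lambda>u. \<Sum>is\<in>R. q is * pds is u)" "finite R" "\<forall>is\<in>R. is_polynomial (q is)"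
    using assms(2) by (auto simp: diff_ops_def)
  define r where "r is = (if is \<in> S then p is else 0) + (if is \<in> R then q is else 0)" for "is"
  have "A u = (\<Sum>is\<in>S \<union> R. (if is \<in> S then p is else 0) * pds is u)" for u
    unfolding A(1) using A(2) B(2) by (intro sum.mono_neutral_cong_left) auto
  moreover have "B u = (\<Sum>is\<in>S \<union> R. (if is \<in> R then q is else 0) * pds is u)" for u
    unfolding B(1) using A(2) B(2) by (intro sum.mono_neutral_cong_left) auto
  ultimately have "(\<lambda>u. A u + B u) = (\<lambda>u. \<Sum>is\<in>S \<union> R. r is * pds is u)"
    by (simp add: r_def distrib_right sum.distrib)
  moreover have "is_polynomial (r is)" for "is"
    using A(3) B(3) by (auto simp: r_def intro: is_polynomial_add is_polynomial_0)
  ultimately show ?thesis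
    using A(2) B(2) unfolding diff_ops_def by blast
qed

lemma diff_ops_sum: "(\<And>s. s \<in> S \<Longrightarrow> h s \<in> diff_ops) \<Longrightarrow> (\<lambda>u. \<Sum>s\<in>S. h s u) \<in> diff_ops"
  by (induction S rule: infinite_finite_induct) (auto intro: diff_ops_zero diff_ops_add)

lemma pds_snoc: "pds (is @ [i]) u = pds is (pd i u)"
  by (simp add: pds_def)

text \<open>With the recurrence \<open>coarb_forest_add_mset_eq\<close> this gives the operators of all forests. Partial
  derivatives on the right of an operator only lengthen its lists of derivatives.\<close>

lemma diff_ops_mult_pds:
  assumes "is_polynomial q" "A \<in> diff_ops"
  shows "(\<lambda>u. q * A (pds js u)) \<in> diff_ops"
proof -
  obtain S p where A: "A = (\<lambda>u. \<Sum>is\<in>S. p is * pds is u)" "finite S" "\<forall>is\<in>S. is_polynomial (p is)"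
    using assms(2) by (auto simp: diff_ops_def)
  have "(\<lambda>u. q * A (pds js u)) = (\<lambda>u. \<Sum>is\<in>S. (q * p is) * pds (is @ js) u)"
    by (simp add: A(1) sum_distrib_left mult.assoc pds_def)
  then show ?thesis
    using A(3) assms(1) by (auto intro!: diff_ops_sum diff_ops_term is_polynomial_mult)
qed

lemma diff_ops_continuous_linear: "A \<in> diff_ops \<Longrightarrow> continuous_linear A"
  by (auto simp: diff_ops_def intro!: continuous_linear_sum_family
      continuous_linear_comp[OF continuous_linear_mult continuous_linear_pds])

lemma diff_ops_polynomial: "A \<in> diff_ops \<Longrightarrow> is_polynomial u \<Longrightarrow> is_polynomial (A u)"
  by (auto simp: diff_ops_def intro!: is_polynomial_sum is_polynomial_mult is_polynomial_pds)


section \<open>Operators of forests\<close>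

lemma symfactor_add_mset: "symfactor (add_mset T F) = of_nat (count F T + 1) * symfactor F"
proof -
  let ?S = "insert T (set_mset F)"
  have "symfactor F = (\<Prod>X\<in>?S. fact (count F X))"
    unfolding symfactor_def by (rule prod.mono_neutral_left) (auto simp: not_in_iff)
  moreover have "symfactor (add_mset T F) = (\<Prod>X\<in>?S. fact (count (add_mset T F) X))"
    by (simp add: symfactor_def)
  moreover have "(\<Prod>X\<in>?S - {T}. fact (count (add_mset T F) X)) = (\<Prod>X\<in>?S - {T}. fact (count F X) :: complex)"
    by (rule prod.cong) auto
  ultimately show ?thesis by (simp add: prod.remove[of ?S T])
qed

lemma symfactor_nonzero: "symfactor F \<noteq> 0"
  by (simp add: symfactor_def)

lemma coarb_tree_var: "coarb_forest \<rho> (bplus \<eta> F) (var i) = coarb_forest \<rho> F (\<rho> \<eta> (var i))"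
  by (simp add: coarb_forest_tree pd_var if_distrib cong: if_cong)

text \<open>The formula that defines the operators of forests of at least two trees also holds for the empty
  forest, and for a single tree because the operator of a tree is a derivation.\<close>

lemma coarb_forest_list:
  "coarb_forest \<rho> (mset Ts) u = const (1 / symfactor (mset Ts)) *
    (\<Sum>is | length is = length Ts.
      (\<Prod>j<length Ts. coarb_forest \<rho> {#Ts ! j#} (var (is ! j))) * pds is u)"
proof (cases "length Ts \<ge> 2")
  case True
  then show ?thesis by (rule coarb_forest_forest)
next
  case False
  then consider "Ts = []" | T where "Ts = [T]"
    by (cases Ts rule: remdups_adj.cases) auto
  then show ?thesis
  proof cases
    case 1
    then show ?thesis by (simp add: coarb_forest_empty symfactor_def pds_def)
  next
    case 2
    obtain \<eta> F where T: "T = Node \<eta> F" by (cases T)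
    have "(\<Sum>is | length is = 1. coarb_forest \<rho> {#T#} (var (is ! 0)) * pds is u) =
        (\<Sum>i\<in>UNIV. coarb_forest \<rho> {#T#} (var i) * pd i u)"
      by (rule sum.reindex_bij_witness[where i = "\<lambda>i. [i]" and j = hd])
        (auto simp: length_Suc_conv pds_def)
    also have "\<dots> = coarb_forest \<rho> {#T#} u"
      using coarb_forest_tree[of \<rho> \<eta> F u] coarb_tree_var[of \<rho> \<eta> F] by (simp add: T bplus_def)
    finally show ?thesis by (simp add: 2 symfactor_def)
  qed
qed

text \<open>The derivative of the Taylor expansion with respect to the parameter of \<open>T\<close>: adding \<open>T\<close> adds one
  derivative, and multiplies the symmetry factor by the new multiplicity of \<open>T\<close>. The expansion of
  products is obtained by induction from this equation.\<close>

lemma coarb_forest_add_mset: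
  "const (of_nat (count F T + 1)) * coarb_forest \<rho> (add_mset T F) u =
    (\<Sum>i\<in>UNIV. coarb_forest \<rho> {#T#} (var i) * coarb_forest \<rho> F (pd i u))"
proof -
  obtain Ts where F: "F = mset Ts" using ex_mset by metis
  let ?A = "\<lambda>T i. coarb_forest \<rho> {#T#} (var i)"
  let ?P = "\<lambda>is. \<Prod>j<length Ts. ?A (Ts ! j) (is ! j)"
  \<comment> \<open>Derivatives commute, so that the new one can be applied to \<open>u\<close> first.\<close>
  have pds: "pds (i # is) u = pds is (pd i u)" for i "is"
    using pds_mset_cong[of "i # is" "is @ [i]"] by (simp add: pds_snoc)
  have "(\<Sum>is | length is = length (T # Ts). (\<Prod>j<length (T # Ts). ?A ((T # Ts) ! j) (is ! j)) * pds is u)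
      = (\<Sum>(i, is)\<in>UNIV \<times> {is. length is = length Ts}. ?A T i * (?P is * pds is (pd i u)))"
    by (rule sum.reindex_bij_witness[where i = "\<lambda>(i, is). i # is" and j = "\<lambda>is. (hd is, tl is)"])
      (auto simp: length_Suc_conv pds prod.lessThan_Suc_shift mult.assoc simp del: prod.lessThan_Suc)
  also have "\<dots> = (\<Sum>i\<in>UNIV. ?A T i * (\<Sum>is | length is = length Ts. ?P is * pds is (pd i u)))"
    by (simp add: sum.cartesian_product sum_distrib_left)
  finally have "const (of_nat (count F T + 1)) * coarb_forest \<rho> (add_mset T F) u =
      const (of_nat (count F T + 1) * (1 / symfactor (add_mset T F))) *
      (\<Sum>i\<in>UNIV. ?A T i * (\<Sum>is | length is = length Ts. ?P is * pds is (pd i u)))"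
    using coarb_forest_list[of \<rho> "T # Ts" u] by (simp only: F const_mult mult.assoc mset.simps)
  also have "of_nat (count F T + 1) * (1 / symfactor (add_mset T F)) = 1 / symfactor F"
    using symfactor_nonzero[of F] by (simp add: symfactor_add_mset field_simps del: of_nat_add of_nat_Suc)
  finally show ?thesis
    using coarb_forest_list[of \<rho> Ts] by (simp only: F sum_distrib_left mult.left_commute)
qed

lemma coarb_forest_add_mset_eq:
  "coarb_forest \<rho> (add_mset T F) u = const (1 / of_nat (count F T + 1)) *
    (\<Sum>i\<in>UNIV. coarb_forest \<rho> {#T#} (var i) * coarb_forest \<rho> F (pd i u))"
proof -
  have "const (1 / of_nat (count F T + 1)) * (const (of_nat (count F T + 1)) * coarb_forest \<rho> (add_mset T F) u)
      = coarb_forest \<rho> (add_mset T F) u"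
    by (simp add: mult.assoc[symmetric] const_mult[symmetric] del: of_nat_add of_nat_Suc)
  then show ?thesis by (simp only: coarb_forest_add_mset)
qed

lemma coarb_forest_0: "coarb_forest \<rho> F 0 = 0"
proof (induction F)
  case (add T F)
  then show ?case
    by (subst coarb_forest_add_mset_eq) (simp add: continuous_linear_0[OF continuous_linear_pd])
qed (simp add: coarb_forest_empty)

lemma coarb_forest_1: "coarb_forest \<rho> F 1 = (if F = {#} then 1 else 0)"
proof (cases F)
  case (add T G)
  then show ?thesis
    using coarb_forest_add_mset_eq[of \<rho> T G 1] by (simp add: pd_1 coarb_forest_0)
qed (simp add: coarb_forest_empty)

text \<open>At least two derivatives are applied to a variable.\<close>

lemma coarb_forest_var_eq_0:
  assumes "size F \<ge> 2"
  shows "coarb_forest \<rho> F (var i) = 0"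
proof -
  obtain T G where F: "F = add_mset T G" using assms by (cases F) auto
  with assms have "G \<noteq> {#}" by auto
  then have "coarb_forest \<rho> G (pd k (var i)) = 0" for k
    by (simp add: pd_var coarb_forest_0 coarb_forest_1)
  then show ?thesis using coarb_forest_add_mset_eq[of \<rho> T G "var i"] by (simp add: F)
qed

text \<open>The coefficients of the operator of a tree are images of the polynomials \<open>\<rho> \<eta> x\<^sub>i\<close> under the
  operator of a smaller forest, and differential operators with polynomial coefficients preserve
  polynomials.\<close>

lemma coarb_forest_diff_ops:
  assumes "\<And>\<eta> i. is_polynomial (\<rho> \<eta> (var i))"
  shows "coarb_forest \<rho> F \<in> diff_ops"
proof -
  have forest: "coarb_forest \<rho> F \<in> diff_ops" if "\<And>T i. T \<in># F \<Longrightarrow> is_polynomial (coarb_forest \<rho> {#T#} (var i))" for F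
    using that
  proof (induction F)
    case empty
    then show ?case
      using diff_ops_term[OF is_polynomial_1, of "[]"] by (simp add: coarb_forest_empty pds_def id_def)
  next
    case (add T F)
    have "(\<lambda>u. (const (1 / of_nat (count F T + 1)) * coarb_forest \<rho> {#T#} (var i)) *
        coarb_forest \<rho> F (pds [i] u)) \<in> diff_ops" for i
      using add by (intro diff_ops_mult_pds is_polynomial_mult is_polynomial_const) auto
    then have "(\<lambda>u. \<Sum>i\<in>UNIV. (const (1 / of_nat (count F T + 1)) * coarb_forest \<rho> {#T#} (var i)) *
        coarb_forest \<rho> F (pds [i] u)) \<in> diff_ops"
      by (rule diff_ops_sum)
    also have "(\<lambda>u. \<Sum>i\<in>UNIV. (const (1 / of_nat (count F T + 1)) * coarb_forest \<rho> {#T#} (var i)) *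
        coarb_forest \<rho> F (pds [i] u)) = coarb_forest \<rho> (add_mset T F)"
      by (rule ext, subst coarb_forest_add_mset_eq) (simp add: sum_distrib_left mult.assoc pds_def)
    finally show ?case .
  qed
  have "is_polynomial (coarb_forest \<rho> {#T#} (var i))" for T i
  proof (induction T arbitrary: i)
    case (Node \<eta> F)
    have "coarb_forest \<rho> F \<in> diff_ops" by (rule forest) (use Node in auto)
    then show ?case
      using diff_ops_polynomial[OF _ assms] coarb_tree_var[of \<rho> \<eta> F i] by (simp add: bplus_def)
  qed
  then show ?thesis by (rule forest)
qed


section \<open>Action on products\<close>

definition msplits :: "'b multiset \<Rightarrow> ('b multiset \<times> 'b multiset) set" where
  "msplits K = {(F, G). F + G = K}"

lemma finite_msplits [simp]: "finite (msplits K)"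
proof (induction K)
  case empty
  have "msplits ({#} :: 'a multiset) = {({#}, {#})}" by (auto simp: msplits_def)
  then show ?case by simp
next
  case (add T K)
  have "msplits (add_mset T K) \<subseteq> map_prod (add_mset T) id ` msplits K \<union> map_prod id (add_mset T) ` msplits K"
  proof clarify
    fix F G assume FG: "(F, G) \<in> msplits (add_mset T K)"
      "(F, G) \<notin> map_prod id (add_mset T) ` msplits K"
    have "T \<in># F + G" using FG(1) by (simp add: msplits_def)
    then have "T \<in># F \<or> T \<in># G" by simp
    then show "(F, G) \<in> map_prod (add_mset T) id ` msplits K"
    proof
      assume "T \<in># F"
      then obtain F' where "F = add_mset T F'" by (rule mset_add)
      with FG(1) show ?thesis by (auto simp: msplits_def intro!: image_eqI[of _ _ "(F', G)"])
    next
      assume "T \<in># G"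
      then obtain G' where "G = add_mset T G'" by (rule mset_add)
      with FG have "(F, G) \<in> map_prod id (add_mset T) ` msplits K"
        by (auto simp: msplits_def intro!: image_eqI[of _ _ "(F, G')"])
      with FG(2) show ?thesis by contradiction
    qed
  qed
  then show ?case using add finite_subset by blast
qed

text \<open>Both sides run over the splittings of \<open>K\<close> with one more \<open>T\<close> on the left. The weight \<open>count F T\<close> kills
  the splittings on the right-hand side that have no \<open>T\<close> on the left, and so spares the binomial
  coefficients.\<close>

lemma sum_msplits_add_mset_left:
  fixes h :: "'b multiset \<Rightarrow> 'b multiset \<Rightarrow> 'c::comm_ring_1"
  shows "(\<Sum>(F, G)\<in>msplits K. of_nat (count F T + 1) * h (add_mset T F) G) =
    (\<Sum>(F, G)\<in>msplits (add_mset T K). of_nat (count F T) * h F G)"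
proof -
  have "(\<Sum>(F, G)\<in>msplits K. of_nat (count F T + 1) * h (add_mset T F) G) =
      (\<Sum>(F, G)\<in>{p \<in> msplits (add_mset T K). T \<in># fst p}. of_nat (count F T) * h F G)"
    by (rule sum.reindex_bij_witness[where i = "\<lambda>(F, G). (F - {#T#}, G)" and j = "\<lambda>(F, G). (add_mset T F, G)"])
      (auto simp: msplits_def multi_member_split)
  also have "\<dots> = (\<Sum>(F, G)\<in>msplits (add_mset T K). of_nat (count F T) * h F G)"
    by (rule sum.mono_neutral_left) (auto, metis mult_zero_left not_in_iff of_nat_0)
  finally show ?thesis .
qed

lemma msplits_swap: "(\<Sum>(F, G)\<in>msplits K. h F G) = (\<Sum>(F, G)\<in>msplits K. h G F)"
  by (rule sum.reindex_bij_witness[where i = prod.swap and j = prod.swap])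
    (auto simp: msplits_def union_commute)

lemma sum_msplits_add_mset_right:
  fixes h :: "'b multiset \<Rightarrow> 'b multiset \<Rightarrow> 'c::comm_ring_1"
  shows "(\<Sum>(F, G)\<in>msplits K. of_nat (count G T + 1) * h F (add_mset T G)) =
    (\<Sum>(F, G)\<in>msplits (add_mset T K). of_nat (count G T) * h F G)"
  using sum_msplits_add_mset_left[where h = "\<lambda>F G. h G F"] msplits_swap[where K = K and h = "\<lambda>F G. of_nat (count G T + 1) * h F (add_mset T G)"]
    msplits_swap[where K = "add_mset T K" and h = "\<lambda>F G. of_nat (count G T) * h F G"]
  by simp

lemma const_of_nat: "const (of_nat n) = (of_nat n :: 'n::finite mps)"
  by (induction n) (simp_all add: const_add)

lemma of_nat_mps_cancel:
  assumes "of_nat (Suc n) * u = of_nat (Suc n) * (v :: 'n::finite mps)"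
  shows "u = v"
proof -
  have "const (1 / of_nat (Suc n)) * (const (of_nat (Suc n)) * w) = w" for w :: "'n mps"
    by (simp add: mult.assoc[symmetric] const_mult[symmetric] del: of_nat_Suc)
  then show ?thesis using assms by (metis const_of_nat)
qed

text \<open>The induction adds a tree \<open>T\<close> to \<open>K\<close>. Multiplied by the multiplicity of \<open>T\<close>, the claim becomes the
  Leibniz rule: the derivatives that fall on \<open>u\<close> produce \<open>T\<close> in the left part of a splitting, those
  that fall on \<open>v\<close> in the right part, and the multiplicities of \<open>T\<close> in the two parts add up to the one
  in the whole forest.\<close>

lemma coarb_forest_mult:
  assumes add: "\<And>F u v. coarb_forest \<rho> F (u + v) = coarb_forest \<rho> F u + coarb_forest \<rho> F v"
  shows "coarb_forest \<rho> K (u * v) = (\<Sum>(F, G)\<in>msplits K. coarb_forest \<rho> F u * coarb_forest \<rho> G v)"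
proof (induction K arbitrary: u v)
  case empty
  have "msplits {#} = {({#}, {#} :: 'a dec rtree multiset)}" by (auto simp: msplits_def)
  then show ?case by (simp add: coarb_forest_empty)
next
  case (add T K)
  let ?E = "coarb_forest \<rho>"
  note rec = coarb_forest_add_mset[of _ _ \<rho>, unfolded const_of_nat]
  have "of_nat (count K T + 1) * ?E (add_mset T K) (u * v) =
      (\<Sum>i\<in>UNIV. ?E {#T#} (var i) * (?E K (pd i u * v) + ?E K (u * pd i v)))"
    by (simp only: rec pd_mult assms)
  also have "\<dots> = (\<Sum>i\<in>UNIV. \<Sum>(F, G)\<in>msplits K. ?E {#T#} (var i) * ?E F (pd i u) * ?E G v) +
      (\<Sum>i\<in>UNIV. \<Sum>(F, G)\<in>msplits K. ?E F u * (?E {#T#} (var i) * ?E G (pd i v)))"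
    by (simp only: add.IH distrib_left sum.distrib sum_distrib_left case_prod_unfold mult.assoc mult.left_commute)
  also have "\<dots> = (\<Sum>(F, G)\<in>msplits K. (\<Sum>i\<in>UNIV. ?E {#T#} (var i) * ?E F (pd i u)) * ?E G v) +
      (\<Sum>(F, G)\<in>msplits K. ?E F u * (\<Sum>i\<in>UNIV. ?E {#T#} (var i) * ?E G (pd i v)))"
    unfolding sum.swap[of _ _ UNIV] by (simp add: split_beta sum_distrib_left sum_distrib_right)
  also have "\<dots> = (\<Sum>(F, G)\<in>msplits K. of_nat (count F T + 1) * (?E (add_mset T F) u * ?E G v)) +
      (\<Sum>(F, G)\<in>msplits K. of_nat (count G T + 1) * (?E F u * ?E (add_mset T G) v))"
    by (simp only: rec[symmetric] mult.assoc mult.left_commute)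
  also have "\<dots> = (\<Sum>(F, G)\<in>msplits (add_mset T K). of_nat (count F T) * (?E F u * ?E G v)) +
      (\<Sum>(F, G)\<in>msplits (add_mset T K). of_nat (count G T) * (?E F u * ?E G v))"
    by (simp only: sum_msplits_add_mset_left[where h = "\<lambda>F G. ?E F u * ?E G v"]
        sum_msplits_add_mset_right[where h = "\<lambda>F G. ?E F u * ?E G v"])
  also have "\<dots> = (\<Sum>(F, G)\<in>msplits (add_mset T K). of_nat (count K T + 1) * (?E F u * ?E G v))"
    unfolding sum.distrib[symmetric]
  proof (intro sum.cong refl, clarify)
    fix F G assume "(F, G) \<in> msplits (add_mset T K)"
    then have "count (F + G) T = count (add_mset T K) T" by (simp add: msplits_def)
    then have "count K T + 1 = count F T + count G T" by simp
    then show "of_nat (count F T) * (?E F u * ?E G v) + of_nat (count G T) * (?E F u * ?E G v) =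
        of_nat (count K T + 1) * (?E F u * ?E G v)"
      by (simp only: of_nat_add distrib_right)
  qed
  finally have "of_nat (Suc (count K T)) * ?E (add_mset T K) (u * v) =
      of_nat (Suc (count K T)) * (\<Sum>(F, G)\<in>msplits (add_mset T K). ?E F u * ?E G v)"
    by (simp only: sum_distrib_left case_prod_unfold Suc_eq_plus1)
  then show ?case by (rule of_nat_mps_cancel)
qed

section \<open>Coefficients of the Connes--Kreimer coproduct\<close>

text \<open>The number of admissible cuts of \<open>K\<close> with pruned part \<open>F\<close> and trunk \<open>G\<close>; as a function of \<open>K\<close>, the
  coefficients of the product of the dual basis elements of \<open>F\<close> and \<open>G\<close>.\<close>

definition cut :: "'n::finite forest \<Rightarrow> 'n forest \<Rightarrow> 'n forest \<Rightarrow> complex" where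
  "cut K F G = Poly_Mapping.lookup (coprod (Poly_Mapping.single K 1)) (F, G)"

lemma cut_eq_0: "gr F + gr G \<noteq> gr K \<Longrightarrow> cut K F G = 0"
  using coprod_homog[of K] unfolding cut_def homog_def by (fastforce simp: in_keys_iff)

lemma cut_empty: "cut {#} F G = (if F = {#} \<and> G = {#} then 1 else 0)"
  by (simp add: cut_def coprod_one lookup_one zero_prod_def when_def)


lemma lookup_mult_msplits:
  fixes y z :: "'n::finite ck2"
  shows "Poly_Mapping.lookup (y * z) (F, G) = (\<Sum>p\<in>msplits F. \<Sum>q\<in>msplits G.
    Poly_Mapping.lookup y (fst p, fst q) * Poly_Mapping.lookup z (snd p, snd q))"
proof -
  let ?y = "Poly_Mapping.lookup y" and ?z = "Poly_Mapping.lookup z"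
  let ?P = "{(k, l). k + l = (F, G)}"
  let ?K = "Poly_Mapping.keys y \<times> Poly_Mapping.keys z"
  have "y * z = (\<Sum>k\<in>Poly_Mapping.keys y. \<Sum>l\<in>Poly_Mapping.keys z. Poly_Mapping.single (k + l) (?y k * ?z l))"
    by (subst sum_singles[of y], subst sum_singles[of z]) (simp add: sum_product mult_single)
  then have "Poly_Mapping.lookup (y * z) (F, G) = (\<Sum>(k, l)\<in>?K. ?y k * ?z l when k + l = (F, G))"
    by (simp add: lookup_sum lookup_single sum.cartesian_product case_prod_unfold)
  also have "\<dots> = (\<Sum>(k, l)\<in>?K \<inter> ?P. ?y k * ?z l)"
    by (rule sum.mono_neutral_cong_right) (auto simp: when_def split: if_splits)
  also have "\<dots> = (\<Sum>(k, l)\<in>?P. ?y k * ?z l)"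
  proof (rule sum.mono_neutral_left)
    have "?P \<subseteq> (\<lambda>(p, q). ((fst p, fst q), (snd p, snd q))) ` (msplits F \<times> msplits G)"
    proof clarify
      fix F1 G1 F2 G2 assume "(F1, G1) + (F2, G2) = (F, G)"
      then show "((F1, G1), (F2, G2)) \<in> (\<lambda>(p, q). ((fst p, fst q), (snd p, snd q))) ` (msplits F \<times> msplits G)"
        by (intro image_eqI[of _ _ "((F1, F2), (G1, G2))"]) (auto simp: msplits_def)
    qed
    then show "finite ?P" by (rule finite_subset) simp
  qed (auto simp: in_keys_iff)
  also have "\<dots> = (\<Sum>(p, q)\<in>msplits F \<times> msplits G. ?y (fst p, fst q) * ?z (snd p, snd q))"
    by (rule sum.reindex_bij_witness[where
          i = "\<lambda>(p, q). ((fst p, fst q), (snd p, snd q))" and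
          j = "\<lambda>(k, l). ((fst k, fst l), (snd k, snd l))"])
      (auto simp: msplits_def)
  finally show ?thesis by (simp add: sum.cartesian_product)
qed

text \<open>The coproduct of \<open>CK\<^sub>H\<close> is multiplicative, and every product of pure tensors is split componentwise.\<close>

lemma cut_union:
  "cut (K + L) F G = (\<Sum>p\<in>msplits F. \<Sum>q\<in>msplits G. cut K (fst p) (fst q) * cut L (snd p) (snd q))"
proof -
  have "Poly_Mapping.single (K + L) 1 = Poly_Mapping.single K (1 :: complex) * Poly_Mapping.single L 1"
    by (simp add: mult_single)
  then show ?thesis by (simp only: cut_def coprod_mult lookup_mult_msplits)
qed

lemma bplus_inject [simp]: "bplus \<eta> F = bplus \<zeta> G \<longleftrightarrow> \<eta> = \<zeta> \<and> F = G"
  and bplus_not_empty [simp]: "bplus \<eta> F \<noteq> {#}" and size_bplus [simp]: "size (bplus \<eta> F) = 1"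
  by (auto simp: bplus_def)

lemma lookup_id_bplus:
  "Poly_Mapping.lookup (id_bplus \<eta> z) (F, bplus \<zeta> G) = (if \<zeta> = \<eta> then Poly_Mapping.lookup z (F, G) else 0)"
proof -
  have "Poly_Mapping.lookup (id_bplus \<eta> z) (F, bplus \<zeta> G) = (\<Sum>k\<in>Poly_Mapping.keys z.
      if k = (F, G) then (if \<zeta> = \<eta> then Poly_Mapping.lookup z (F, G) else 0) else 0)"
    unfolding id_bplus_def lookup_sum
    by (rule sum.cong) (auto simp: lookup_single when_def split: if_splits)
  then show ?thesis by (simp add: in_keys_iff)
qed

lemma lookup_id_bplus_eq_0:
  assumes "\<And>\<zeta> G'. G \<noteq> bplus \<zeta> G'"
  shows "Poly_Mapping.lookup (id_bplus \<eta> z) (F, G) = 0"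
proof -
  have "bplus \<eta> G' \<noteq> G" for G' using assms by metis
  then show ?thesis
    unfolding id_bplus_def lookup_sum by (intro sum.neutral) (auto simp: lookup_single when_def)
qed

lemma cut_bplus_bplus: "cut (bplus \<eta> K) F (bplus \<zeta> G) = (if \<zeta> = \<eta> then cut K F G else 0)"
  by (simp add: cut_def coprod_bplus lookup_add lookup_id_bplus lookup_single)

lemma cut_bplus_not_bplus:
  "(\<And>\<zeta> G'. G \<noteq> bplus \<zeta> G') \<Longrightarrow> cut (bplus \<eta> K) F G = (if F = bplus \<eta> K \<and> G = {#} then 1 else 0)"
  by (simp add: cut_def coprod_bplus lookup_add lookup_id_bplus_eq_0 lookup_single when_def)

text \<open>A pair of forests is a splitting of exactly one forest, their union. The hypothesis makes the
  truncation by degree of the union the same as that of the two parts.\<close>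

lemma sum_msplits_gr:
  fixes h :: "'n::finite forest \<Rightarrow> 'n forest \<Rightarrow> 'c::comm_monoid_add"
  assumes "\<And>F G. gr F + gr G > M \<Longrightarrow> h F G = 0"
  shows "(\<Sum>K | gr K \<le> M. \<Sum>(F, G)\<in>msplits K. h F G) = (\<Sum>F | gr F \<le> M. \<Sum>G | gr G \<le> M. h F G)"
proof -
  let ?B = "{K :: 'n forest. gr K \<le> M}"
  have nonneg: "gr F \<ge> 0" for F :: "'n forest" using gr_ge_size[of F] by linarith
  have "(\<Sum>K\<in>?B. \<Sum>(F, G)\<in>msplits K. h F G) = (\<Sum>(K, p)\<in>Sigma ?B msplits. h (fst p) (snd p))"
    by (simp add: sum.Sigma finite_gr_le split_beta)
  also have "\<dots> = (\<Sum>p\<in>{p :: 'n forest \<times> 'n forest. gr (fst p) + gr (snd p) \<le> M}. h (fst p) (snd p))"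
    by (rule sum.reindex_bij_witness[where i = "\<lambda>p. (fst p + snd p, p)" and j = snd])
      (auto simp: msplits_def)
  also have "\<dots> = (\<Sum>p\<in>?B \<times> ?B. h (fst p) (snd p))"
  proof (rule sum.mono_neutral_left)
    show "{p :: 'n forest \<times> 'n forest. gr (fst p) + gr (snd p) \<le> M} \<subseteq> ?B \<times> ?B"
    proof
      fix p :: "'n forest \<times> 'n forest" assume "p \<in> {p :: 'n forest \<times> 'n forest. gr (fst p) + gr (snd p) \<le> M}"
      then have "gr (fst p) \<le> M" "gr (snd p) \<le> M"
        using nonneg[of "fst p"] nonneg[of "snd p"] by simp_all
      then show "p \<in> ?B \<times> ?B" by (cases p) simp
    qed
  qed (auto simp: finite_gr_le not_le intro!: assms)
  finally show ?thesis by (simp add: sum.cartesian_product split_beta)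
qed


section \<open>Composition of forest operators\<close>

text \<open>On a variable only the empty forest and the trees count. If \<open>G\<close> is empty, the only cut is the total
  one, \<open>K = F\<close>. If \<open>G = B\<^sup>+(G')\<close> has root \<open>\<eta>\<close>, the trees \<open>K\<close> with trunk \<open>G\<close> have the root \<open>\<eta>\<close> as well, and
  their cuts are those of the forest above the root. In all other cases both sides vanish.\<close>

lemma cut_expansion_var:
  assumes IH: "\<And>\<eta> G' M. G = bplus \<eta> G' \<Longrightarrow> gr F + gr G' \<le> M \<Longrightarrow>
      coarb_forest \<rho> F (coarb_forest \<rho> G' (\<rho> \<eta> (var i))) =
        (\<Sum>K | gr K \<le> M. const (cut K F G') * coarb_forest \<rho> K (\<rho> \<eta> (var i)))"
    and M: "gr F + gr G \<le> M"
  shows "coarb_forest \<rho> F (coarb_forest \<rho> G (var i)) =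
    (\<Sum>K | gr K \<le> M. const (cut K F G) * coarb_forest \<rho> K (var i))"
proof -
  let ?E = "coarb_forest \<rho>" and ?B = "{K. gr K \<le> M}"
  have small: "K = {#} \<or> (\<exists>\<eta> K'. K = bplus \<eta> K')" if "size K < 2" for K :: "'a forest"
  proof -
    have "size K = 0 \<or> size K = 1" using that by linarith
    then show ?thesis by (metis bplus_def rtree.exhaust size_1_singleton_mset size_eq_0_iff_empty)
  qed
  consider "G = {#}" | \<eta> G' where "G = bplus \<eta> G'" | "size G \<ge> 2"
    using small[of G] by force
  then show ?thesis
  proof cases
    case 1
    have "const (cut K F G) * ?E K (var i) = (if K = F then ?E F (var i) else 0)" for K
    proof (cases "size K < 2")
      case True
      then show ?thesis using small[OF True] by (auto simp: 1 cut_empty cut_bplus_not_bplus)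
    qed (auto simp: coarb_forest_var_eq_0)
    then show ?thesis using M 1 by (simp add: finite_gr_le coarb_forest_empty)
  next
    case (2 \<eta> G')
    let ?B' = "{K. gr K \<le> M - grd \<eta>}"
    have "(\<Sum>K\<in>?B. const (cut K F G) * ?E K (var i)) =
        (\<Sum>K\<in>bplus \<eta> ` ?B'. const (cut K F G) * ?E K (var i))"
    proof (rule sum.mono_neutral_right)
      show "\<forall>K\<in>?B - bplus \<eta> ` ?B'. const (cut K F G) * ?E K (var i) = 0"
      proof
        fix K assume K: "K \<in> ?B - bplus \<eta> ` ?B'"
        show "const (cut K F G) * ?E K (var i) = 0"
        proof (cases "size K < 2")
          case True
          have "cut K F G = 0"
            using small[OF True] K by (auto simp: 2 cut_empty cut_bplus_bplus)
          then show ?thesis by simp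
        qed (auto simp: coarb_forest_var_eq_0)
      qed
    qed (auto simp: finite_gr_le)
    also have "\<dots> = (\<Sum>K\<in>?B'. const (cut K F G') * ?E K (\<rho> \<eta> (var i)))"
      by (simp add: sum.reindex inj_on_def 2 cut_bplus_bplus coarb_tree_var)
    also have "\<dots> = ?E F (?E G' (\<rho> \<eta> (var i)))"
      using IH[OF 2, of "M - grd \<eta>"] M by (simp add: 2)
    finally show ?thesis by (simp add: 2 coarb_tree_var)
  next
    case 3
    then have not_bplus: "G \<noteq> bplus \<zeta> G'" and "G \<noteq> {#}" for \<zeta> G' by auto
    have "const (cut K F G) * ?E K (var i) = 0" for K
    proof (cases "size K < 2")
      case True
      then show ?thesis
        using small[OF True] \<open>G \<noteq> {#}\<close> by (auto simp: cut_empty cut_bplus_not_bplus[OF not_bplus])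
    qed (auto simp: coarb_forest_var_eq_0)
    then show ?thesis using 3 by (simp add: coarb_forest_var_eq_0 coarb_forest_0)
  qed
qed

text \<open>Expanding \<open>E\<^sub>F (E\<^sub>G (u v))\<close> splits \<open>F\<close> and \<open>G\<close> independently, and expanding the right-hand side
  splits \<open>K\<close>; the two double sums agree by \<open>cut_union\<close>. The expansions of \<open>u\<close> and \<open>v\<close> are used for all
  parts of \<open>F\<close> and \<open>G\<close>, hence the bound \<open>N\<close> that the degree of \<open>G\<close> passes on to its parts.\<close>

lemma cut_expansion_mult:
  fixes \<rho> :: "'n::finite dec \<Rightarrow> 'n operator"
  assumes cl: "\<And>F. continuous_linear (coarb_forest \<rho> F)"
    and u: "\<And>F G. gr G \<le> N \<Longrightarrow> gr F + gr G \<le> M \<Longrightarrow> coarb_forest \<rho> F (coarb_forest \<rho> G u) =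
        (\<Sum>K | gr K \<le> M. const (cut K F G) * coarb_forest \<rho> K u)"
    and v: "\<And>F G. gr G \<le> N \<Longrightarrow> gr F + gr G \<le> M \<Longrightarrow> coarb_forest \<rho> F (coarb_forest \<rho> G v) =
        (\<Sum>K | gr K \<le> M. const (cut K F G) * coarb_forest \<rho> K v)"
    and N: "gr G \<le> N" and M: "gr F + gr G \<le> M"
  shows "coarb_forest \<rho> F (coarb_forest \<rho> G (u * v)) =
    (\<Sum>K | gr K \<le> M. const (cut K F G) * coarb_forest \<rho> K (u * v))"
proof -
  let ?E = "coarb_forest \<rho>" and ?B = "{K. gr K \<le> M}"
  note mult = coarb_forest_mult[OF continuous_linear_add[OF cl]]
  have gr_nonneg: "gr K \<ge> 0" for K :: "'n forest" using gr_ge_size[of K] by linarith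
  have parts: "?E (fst p) (?E (fst q) u) * ?E (snd p) (?E (snd q) v) =
      (\<Sum>K\<in>?B. \<Sum>L\<in>?B. const (cut K (fst p) (fst q) * cut L (snd p) (snd q)) * (?E K u * ?E L v))"
    if "p \<in> msplits F" "q \<in> msplits G" for p q
  proof -
    have "gr (fst p) + gr (snd p) = gr F" "gr (fst q) + gr (snd q) = gr G"
      using that by (auto simp: msplits_def)
    then have "gr (fst q) \<le> N" "gr (snd q) \<le> N" "gr (fst p) + gr (fst q) \<le> M" "gr (snd p) + gr (snd q) \<le> M"
      using N M gr_nonneg[of "fst p"] gr_nonneg[of "fst q"] gr_nonneg[of "snd p"] gr_nonneg[of "snd q"]
      by linarith+
    then show ?thesis
      by (simp add: u v sum_product const_mult mult_ac)
  qed
  have "?E F (?E G (u * v)) =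
      (\<Sum>q\<in>msplits G. \<Sum>p\<in>msplits F. ?E (fst p) (?E (fst q) u) * ?E (snd p) (?E (snd q) v))"
    by (simp add: mult continuous_linear_sum[OF cl] split_beta)
  also have "\<dots> = (\<Sum>p\<in>msplits F. \<Sum>q\<in>msplits G. ?E (fst p) (?E (fst q) u) * ?E (snd p) (?E (snd q) v))"
    by (rule sum.swap)
  also have "\<dots> = (\<Sum>p\<in>msplits F. \<Sum>q\<in>msplits G. \<Sum>K\<in>?B. \<Sum>L\<in>?B.
      const (cut K (fst p) (fst q) * cut L (snd p) (snd q)) * (?E K u * ?E L v))"
    by (intro sum.cong refl parts)
  also have "\<dots> = (\<Sum>K\<in>?B. \<Sum>L\<in>?B. \<Sum>p\<in>msplits F. \<Sum>q\<in>msplits G.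
      const (cut K (fst p) (fst q) * cut L (snd p) (snd q)) * (?E K u * ?E L v))"
    by (simp only: sum.swap[of _ ?B "msplits _"])
  also have "\<dots> = (\<Sum>K\<in>?B. \<Sum>L\<in>?B. const (cut (K + L) F G) * (?E K u * ?E L v))"
    by (simp add: cut_union const_sum sum_distrib_right)
  also have "\<dots> = (\<Sum>K\<in>?B. \<Sum>(K', L')\<in>msplits K. const (cut (K' + L') F G) * (?E K' u * ?E L' v))"
  proof (rule sum_msplits_gr[symmetric])
    fix K L :: "'n forest" assume "gr K + gr L > M"
    then have "cut (K + L) F G = 0" using M by (intro cut_eq_0) simp
    then show "const (cut (K + L) F G) * (?E K u * ?E L v) = 0" by simp
  qed
  also have "\<dots> = (\<Sum>K\<in>?B. const (cut K F G) * ?E K (u * v))"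
    unfolding mult sum_distrib_left
    by (intro sum.cong refl) (auto simp: msplits_def)
  finally show ?thesis .
qed

text \<open>The bound \<open>M\<close> only has to be large enough: forests \<open>K\<close> of degree other than \<open>gr F + gr G\<close> have no
  cut into \<open>F\<close> and \<open>G\<close>. A common bound keeps the range of summation fixed when \<open>F\<close> and \<open>G\<close> are split.\<close>

lemma coarb_forest_comp:
  fixes \<rho> :: "'n::finite dec \<Rightarrow> 'n operator"
  assumes cl: "\<And>F. continuous_linear (coarb_forest \<rho> F)"
    and "gr F + gr G \<le> M"
  shows "coarb_forest \<rho> F (coarb_forest \<rho> G u) =
    (\<Sum>K | gr K \<le> M. const (cut K F G) * coarb_forest \<rho> K u)"
  using assms(2)
proof (induction "nat (gr G)" arbitrary: F G M u rule: less_induct)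
  case less
  let ?E = "coarb_forest \<rho>"
  \<comment> \<open>Products require the claim for all parts of \<open>G\<close>, whose degrees need not be smaller; hence the
    claim is proved for one \<open>u\<close> and all forests of degree at most \<open>gr G\<close> at once.\<close>
  define good where "good u \<longleftrightarrow> (\<forall>F G'. gr G' \<le> gr G \<longrightarrow> gr F + gr G' \<le> M \<longrightarrow>
      ?E F (?E G' u) = (\<Sum>K | gr K \<le> M. const (cut K F G') * ?E K u))" for u
  have gr_nonneg: "gr K \<ge> 0" for K :: "'n forest" using gr_ge_size[of K] by linarith
  have "good (xmono \<beta>)" for \<beta>
  proof (rule xmono_induct)
    have "?E F (?E G' 1) = (\<Sum>K | gr K \<le> M. const (cut K F G') * ?E K 1)"
      if "gr F + gr G' \<le> M" for F G'
    proof -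
      have "0 \<le> M" using that gr_nonneg[of F] gr_nonneg[of G'] by linarith
      have "(\<Sum>K | gr K \<le> M. const (cut K F G') * ?E K 1) =
          (\<Sum>K :: 'n forest | gr K \<le> M. if K = {#} then const (cut {#} F G') else 0)"
        by (rule sum.cong) (auto simp: coarb_forest_1)
      also have "\<dots> = const (cut {#} F G')" using \<open>0 \<le> M\<close> by (simp add: finite_gr_le)
      also have "\<dots> = ?E F (?E G' 1)" by (auto simp: cut_empty coarb_forest_1 coarb_forest_0)
      finally show ?thesis ..
    qed
    then show "good 1" by (simp add: good_def)
  next
    fix i
    \<comment> \<open>The induction hypothesis enters only here, for the series \<open>\<rho> \<eta> x\<^sub>i\<close> in place of the variable.\<close>
    have "?E F (?E G' (var i)) = (\<Sum>K | gr K \<le> M. const (cut K F G') * ?E K (var i))"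
      if G': "gr G' \<le> gr G" and M: "gr F + gr G' \<le> M" for F G'
    proof (rule cut_expansion_var[OF _ M])
      fix \<eta> G'' M' assume G'': "G' = bplus \<eta> G''" and M': "gr F + gr G'' \<le> M'"
      have "gr G'' < gr G" using G' G'' grd_ge_1[of \<eta>] by simp
      then have "nat (gr G'') < nat (gr G)" using gr_nonneg[of G''] by linarith
      then show "?E F (?E G'' (\<rho> \<eta> (var i))) =
          (\<Sum>K | gr K \<le> M'. const (cut K F G'') * ?E K (\<rho> \<eta> (var i)))"
        using M' by (rule less.hyps)
    qed
    then show "good (var i)" by (simp add: good_def)
  next
    fix u v assume "good u" "good v"
    then show "good (u * v)"
      unfolding good_def using cut_expansion_mult[OF cl, of "gr G" M u v] by blast
  qed
  then have "?E F (?E G (xmono \<beta>)) = (\<Sum>K | gr K \<le> M. const (cut K F G) * ?E K (xmono \<beta>))" for \<beta>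
    using less.prems by (simp add: good_def)
  moreover have "continuous_linear (\<lambda>u. ?E F (?E G u))"
    by (rule continuous_linear_comp[OF cl cl])
  moreover have "continuous_linear (\<lambda>u. \<Sum>K | gr K \<le> M. const (cut K F G) * ?E K u)"
    by (intro continuous_linear_sum_family continuous_linear_comp[OF continuous_linear_mult cl])
  ultimately show ?case using continuous_linear_eqI by blast
qed


section \<open>The Hopf morphism\<close>

lemma coarb_eq:
  assumes "\<And>F. gr F > M \<Longrightarrow> D (Poly_Mapping.single F 1) = 0"
  shows "coarb \<rho> D u = (\<Sum>F | gr F \<le> M. const (D (Poly_Mapping.single F 1)) * coarb_forest \<rho> F u)"
proof -
  have "{F. D (Poly_Mapping.single F 1) \<noteq> 0} \<subseteq> {F. gr F \<le> M}"
    using assms by (auto simp: not_less[symmetric])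
  then show ?thesis
    unfolding coarb_def by (intro sum.mono_neutral_left) (auto simp: finite_gr_le)
qed

lemma ck_dual_bound:
  assumes "finite S" "S \<subseteq> ck_dual"
  shows "\<exists>M. \<forall>D\<in>S. \<forall>F. gr F > M \<longrightarrow> D (Poly_Mapping.single F 1) = 0"
  using assms
proof (induction S rule: finite_induct)
  case (insert D S)
  then obtain M N where "\<forall>D\<in>S. \<forall>F. gr F > M \<longrightarrow> D (Poly_Mapping.single F 1) = 0"
    and "\<forall>F. gr F > N \<longrightarrow> D (Poly_Mapping.single F 1) = 0"
    by (auto simp: ck_dual_def)
  then show ?case by (intro exI[of _ "max M N"]) auto
qed simp

lemma coarb_dual_mult:
  fixes \<rho> :: "'n::finite dec \<Rightarrow> 'n operator"
  assumes cl: "\<And>F. continuous_linear (coarb_forest \<rho> F)"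
    and D: "D \<in> ck_dual" and E: "E \<in> ck_dual"
  shows "coarb \<rho> (dual_mult D E) u = coarb \<rho> D (coarb \<rho> E u)"
proof -
  let ?d = "\<lambda>F. D (Poly_Mapping.single F 1)" and ?e = "\<lambda>F. E (Poly_Mapping.single F 1)"
  obtain N where N: "\<And>F. gr F > N \<Longrightarrow> ?d F = 0" "\<And>F. gr F > N \<Longrightarrow> ?e F = 0"
    using ck_dual_bound[of "{D, E}"] D E
    by (metis finite.emptyI finite.insertI empty_subsetI insert_subset insertCI)
  let ?B = "{F :: 'n forest. gr F \<le> N}"
  have prod: "dual_mult D E (Poly_Mapping.single K 1) = (\<Sum>F\<in>?B. \<Sum>G\<in>?B. cut K F G * ?d F * ?e G)" for K
  proof -
    let ?K = "Poly_Mapping.keys (coprod (Poly_Mapping.single K (1 :: complex)))"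
    let ?t = "\<lambda>(F, G). cut K F G * ?d F * ?e G"
    have "dual_mult D E (Poly_Mapping.single K 1) = (\<Sum>p\<in>?K. ?t p)"
      by (simp add: dual_mult_def tensor_def cut_def)
    also have "\<dots> = (\<Sum>p\<in>?K \<union> ?B \<times> ?B. ?t p)"
      by (rule sum.mono_neutral_left) (auto simp: finite_gr_le cut_def in_keys_iff)
    also have "\<dots> = (\<Sum>p\<in>?B \<times> ?B. ?t p)"
    proof (rule sum.mono_neutral_right)
      show "\<forall>p\<in>(?K \<union> ?B \<times> ?B) - ?B \<times> ?B. ?t p = 0"
      proof
        fix p assume p: "p \<in> (?K \<union> ?B \<times> ?B) - ?B \<times> ?B"
        obtain F G where FG: "p = (F, G)" by (cases p)
        with p have "gr F > N \<or> gr G > N" by auto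
        then show "?t p = 0" using N by (auto simp: FG)
      qed
    qed (auto simp: finite_gr_le)
    finally show ?thesis by (simp add: sum.cartesian_product)
  qed
  have "dual_mult D E (Poly_Mapping.single K 1) = 0" if "gr K > N + N" for K
    unfolding prod
  proof (intro sum.neutral ballI)
    fix F G assume "F \<in> ?B" "G \<in> ?B"
    then have "cut K F G = 0" using that by (intro cut_eq_0) auto
    then show "cut K F G * ?d F * ?e G = 0" by simp
  qed
  then have "coarb \<rho> (dual_mult D E) u = (\<Sum>K | gr K \<le> N + N.
      const (dual_mult D E (Poly_Mapping.single K 1)) * coarb_forest \<rho> K u)"
    by (rule coarb_eq)
  also have "\<dots> = (\<Sum>K | gr K \<le> N + N. \<Sum>F\<in>?B. \<Sum>G\<in>?B.
      const (?d F) * (const (?e G) * (const (cut K F G) * coarb_forest \<rho> K u)))"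
    by (simp only: prod const_sum const_mult sum_distrib_right, simp only: mult_ac)
  also have "\<dots> = (\<Sum>F\<in>?B. \<Sum>G\<in>?B. \<Sum>K | gr K \<le> N + N.
      const (?d F) * (const (?e G) * (const (cut K F G) * coarb_forest \<rho> K u)))"
    by (subst sum.swap, rule sum.cong[OF refl], rule sum.swap)
  also have "\<dots> = (\<Sum>F\<in>?B. \<Sum>G\<in>?B. const (?d F) * (const (?e G) * coarb_forest \<rho> F (coarb_forest \<rho> G u)))"
  proof (intro sum.cong refl)
    fix F G assume "F \<in> ?B" "G \<in> ?B"
    then have "gr F + gr G \<le> N + N" by simp
    then show "(\<Sum>K | gr K \<le> N + N. const (?d F) * (const (?e G) * (const (cut K F G) * coarb_forest \<rho> K u))) =
        const (?d F) * (const (?e G) * coarb_forest \<rho> F (coarb_forest \<rho> G u))"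
      by (simp add: coarb_forest_comp[OF cl] sum_distrib_left)
  qed
  also have "\<dots> = coarb \<rho> D (coarb \<rho> E u)"
    by (simp add: coarb_eq[of N D, OF N(1)] coarb_eq[of N E, OF N(2)] sum_distrib_left
        continuous_linear_sum[OF cl] continuous_linear_const[OF cl])
  finally show ?thesis .
qed

lemma tensor_single: "tensor \<phi> \<psi> (Poly_Mapping.single (F, G) 1) =
    \<phi> (Poly_Mapping.single F 1) * \<psi> (Poly_Mapping.single G 1)"
  by (simp add: tensor_def)

lemma sum_sum_list: "(\<Sum>s\<in>S. \<Sum>x\<leftarrow>xs. h s x) = (\<Sum>x\<leftarrow>xs. \<Sum>s\<in>S. h s x)"
  by (induction xs) (simp_all add: sum.distrib)

lemma const_sum_list: "const (\<Sum>x\<leftarrow>xs. h x) = (\<Sum>x\<leftarrow>xs. const (h x))"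
  by (induction xs) (simp_all add: const_add)

text \<open>Evaluated on \<open>F \<otimes> G\<close>, the given decomposition of the coproduct says how the value of \<open>D\<close> on \<open>F + G\<close>
  splits, so that the result does not depend on the decomposition. A common degree bound for \<open>D\<close> and
  all factors makes the sums finite.\<close>

lemma coarb_dual_coprod:
  fixes \<rho> :: "'n::finite dec \<Rightarrow> 'n operator" and DD :: "('n functional \<times> 'n functional) list"
  assumes cl: "\<And>F. continuous_linear (coarb_forest \<rho> F)"
    and D: "D \<in> ck_dual" and DD: "set DD \<subseteq> ck_dual \<times> ck_dual"
    and eq: "dual_coprod D = (\<lambda>z. \<Sum>(D1, D2)\<leftarrow>DD. tensor D1 D2 z)"
  shows "coarb \<rho> D (u * v) = (\<Sum>(D1, D2)\<leftarrow>DD. coarb \<rho> D1 u * coarb \<rho> D2 v)"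
proof -
  let ?E = "coarb_forest \<rho>" and ?d = "\<lambda>D F. D (Poly_Mapping.single F 1)"
  have "insert D (fst ` set DD \<union> snd ` set DD) \<subseteq> ck_dual" using D DD by auto
  then obtain N where N: "\<And>A F. A \<in> insert D (fst ` set DD \<union> snd ` set DD) \<Longrightarrow> gr F > N \<Longrightarrow> ?d A F = 0"
    using ck_dual_bound[of "insert D (fst ` set DD \<union> snd ` set DD)"]
    by (metis finite_Un finite_imageI finite_insert finite_set)
  let ?B = "{F :: 'n forest. gr F \<le> N}"
  have pair: "?d D (F + G) = (\<Sum>x\<leftarrow>DD. ?d (fst x) F * ?d (snd x) G)" for F G
    using fun_cong[OF eq, of "Poly_Mapping.single (F, G) 1"]
    by (simp add: dual_coprod_def mult_ck_def tensor_single case_prod_unfold)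
  have "coarb \<rho> D (u * v) = (\<Sum>K\<in>?B. \<Sum>(F, G)\<in>msplits K. const (?d D (F + G)) * (?E F u * ?E G v))"
    by (subst coarb_eq[of N]) (auto simp: N coarb_forest_mult[OF continuous_linear_add[OF cl]]
        sum_distrib_left msplits_def intro!: sum.cong)
  also have "\<dots> = (\<Sum>F\<in>?B. \<Sum>G\<in>?B. const (?d D (F + G)) * (?E F u * ?E G v))"
    by (rule sum_msplits_gr) (simp add: N)
  also have "\<dots> = (\<Sum>F\<in>?B. \<Sum>G\<in>?B. \<Sum>x\<leftarrow>DD. (const (?d (fst x) F) * ?E F u) * (const (?d (snd x) G) * ?E G v))"
    by (simp only: pair const_sum_list const_mult sum_list_mult_const[symmetric], simp only: mult_ac)
  also have "\<dots> = (\<Sum>x\<leftarrow>DD. (\<Sum>F\<in>?B. const (?d (fst x) F) * ?E F u) * (\<Sum>G\<in>?B. const (?d (snd x) G) * ?E G v))"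
    by (simp add: sum_sum_list sum_product)
  also have "\<dots> = (\<Sum>x\<leftarrow>DD. coarb \<rho> (fst x) u * coarb \<rho> (snd x) v)"
  proof (intro arg_cong[of _ _ sum_list] map_cong refl)
    fix x assume x: "x \<in> set DD"
    have "coarb \<rho> (fst x) u = (\<Sum>F\<in>?B. const (?d (fst x) F) * ?E F u)"
      "coarb \<rho> (snd x) v = (\<Sum>F\<in>?B. const (?d (snd x) F) * ?E F v)"
      by (rule coarb_eq; use x N in force)+
    then show "(\<Sum>F\<in>?B. const (?d (fst x) F) * ?E F u) * (\<Sum>G\<in>?B. const (?d (snd x) G) * ?E G v) =
        coarb \<rho> (fst x) u * coarb \<rho> (snd x) v" by simp
  qed
  finally show ?thesis by (simp add: case_prod_unfold)
qed

theorem theorem5: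
  fixes a :: "'n::finite \<Rightarrow> 'n dec \<Rightarrow> complex"
    and \<rho> :: "'n dec \<Rightarrow> 'n operator"
  assumes "\<And>i \<eta>. expo \<eta> \<notin> Hi i \<Longrightarrow> a i \<eta> = 0"
    and "\<rho> = vf_comp a \<or> \<rho> = diffeo_comp a"
  shows "(\<forall>D\<in>ck_dual. coarb \<rho> D \<in> diff_ops) \<and>
    (\<forall>c d. \<forall>D\<in>ck_dual. \<forall>E\<in>ck_dual. \<forall>u.
       coarb \<rho> (\<lambda>w. c * D w + d * E w) u = const c * coarb \<rho> D u + const d * coarb \<rho> E u) \<and>
    coarb \<rho> dual_unit = id \<and>
    (\<forall>D\<in>ck_dual. \<forall>E\<in>ck_dual. coarb \<rho> (dual_mult D E) = coarb \<rho> D \<circ> coarb \<rho> E) \<and>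
    (\<forall>D\<in>ck_dual. \<forall>DD :: ('n functional \<times> 'n functional) list.
       set DD \<subseteq> ck_dual \<times> ck_dual \<longrightarrow>
       dual_coprod D = (\<lambda>z. \<Sum>(D1, D2)\<leftarrow>DD. tensor D1 D2 z) \<longrightarrow>
       (\<forall>u v. coarb \<rho> D (u * v) = (\<Sum>(D1, D2)\<leftarrow>DD. coarb \<rho> D1 u * coarb \<rho> D2 v)))"
proof -
  have "\<rho> \<eta> (var i) = const (a i \<eta>) * xpow (\<lambda>j. expo \<eta> j + ei i j)" for \<eta> i
    using assms(2) vf_comp_var diffeo_comp_var by metis
  then have forest_ops: "coarb_forest \<rho> F \<in> diff_ops" for F
    by (intro coarb_forest_diff_ops) (simp add: is_polynomial_mult is_polynomial_const is_polynomial_xpow)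
  then have cl: "continuous_linear (coarb_forest \<rho> F)" for F by (rule diff_ops_continuous_linear)
  have "coarb \<rho> D \<in> diff_ops" for D
  proof -
    have "(\<lambda>u. \<Sum>F | D (Poly_Mapping.single F 1) \<noteq> 0.
        const (D (Poly_Mapping.single F 1)) * coarb_forest \<rho> F (pds [] u)) \<in> diff_ops"
      by (intro diff_ops_sum diff_ops_mult_pds is_polynomial_const forest_ops)
    then show ?thesis by (simp add: coarb_def[abs_def] pds_def)
  qed
  moreover have "coarb \<rho> (\<lambda>w. c * D w + d * E w) u = const c * coarb \<rho> D u + const d * coarb \<rho> E u"
    if DE: "D \<in> ck_dual" "E \<in> ck_dual" for c d D E u
  proof -
    obtain N where N: "\<And>F. gr F > N \<Longrightarrow> D (Poly_Mapping.single F 1) = 0"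
      "\<And>F. gr F > N \<Longrightarrow> E (Poly_Mapping.single F 1) = 0"
      using ck_dual_bound[of "{D, E}"] DE
    by (metis finite.emptyI finite.insertI empty_subsetI insert_subset insertCI)
    show ?thesis
      by (simp add: coarb_eq[of N] N const_add const_mult distrib_right sum.distrib sum_distrib_left mult.assoc)
  qed
  moreover have "coarb \<rho> dual_unit = id"
    by (simp add: dual_unit_def coarb_dual_basis coarb_forest_empty)
  moreover have "coarb \<rho> (dual_mult D E) = coarb \<rho> D \<circ> coarb \<rho> E" if "D \<in> ck_dual" "E \<in> ck_dual" for D E
    using coarb_dual_mult[OF cl that] by (simp add: fun_eq_iff)
  ultimately show ?thesis using coarb_dual_coprod[OF cl] by blast
qed

end
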